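(* Let $F$ be a field of characteristic $0$ and let $d,m$ be positive integers with $m\le 2d$. Then $ST(m^{[d;m]}\oplus(m-1))$ is NOT a tensor polynomial identity for $d\times d$ matrices $M_d(F)$ if and only if either $m$ is even, or $m$ is odd and $m\le d$.
   Context: $[d;m]:=\sum_{i=1}^d\lfloor(2i-1)/m\rfloor$. $m^r$ is the partition with $r$ parts equal to $m$; $\lambda\oplus\mu$ is the partition with the parts of $\lambda$ and $\mu$ arranged non-increasingly (a part $0$ is omitted). For a partition $\lambda=(h_1,\dots,h_n)\vdash k$, $ST(\lambda)(x_1,\dots,x_k):=\sum_{\tau\in S_k}\epsilon_\tau(X_1\otimes\cdots\otimes X_n)(x_{\tau(1)},\dots,x_{\tau(k)})\in F\langle X\rangle^{\otimes n}$ with $X_j:=x_{h_1+\dots+h_{j-1}+1}\cdots x_{h_1+\dots+h_j}$, $F\langle X\rangle$ the free associative algebra. A tensor polynomial identity for $M_d(F)$ is a tensor polynomial vanishing under every evaluation $x_i\mapsto A_i\in M_d(F)$. *)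

theory Defs
  imports "Jordan_Normal_Form.Matrix" "HOL-Combinatorics.Permutations"
begin

definition bracket :: "nat \<Rightarrow> nat \<Rightarrow> nat" where
  "bracket d m = (\<Sum>i=1..d. (2*i - 1) div m)"

text \<open>The partition m^r (+) mu as the non-increasing list of its (positive) parts;
  the partition m^{[d;m]} (+) (m-1), where a part 0 is omitted.\<close>
definition thm_partition :: "nat \<Rightarrow> nat \<Rightarrow> nat list" where
  "thm_partition d m = replicate (bracket d m) m @ (if m - 1 > 0 then [m - 1] else [])"

definition mat_list_prod :: "nat \<Rightarrow> 'a::semiring_1 mat list \<Rightarrow> 'a mat" where
  "mat_list_prod d As = foldr (*) As (1\<^sub>m d)"

text \<open>Evaluation of ST(lambda)(x_1,...,x_k) under x_{i+1} |-> A i (variables 0-indexed),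
  as an element of M_d(F)^{tensor n}, given by its coordinates: the coordinate of
  B_1 (x) ... (x) B_n at the index tuple ((a_1,b_1),...,(a_n,b_n)) is
  prod_j B_j(a_j,b_j).  Here ab j = (a_j,b_j) for j < n.\<close>
definition ST_eval :: "nat list \<Rightarrow> nat \<Rightarrow> (nat \<Rightarrow> 'a::comm_ring_1 mat) \<Rightarrow> (nat \<Rightarrow> nat \<times> nat) \<Rightarrow> 'a" where
  "ST_eval lam d A ab =
     (\<Sum>p | p permutes {0..<sum_list lam}.
        of_int (sign p) *
        (\<Prod>j<length lam.
           mat_list_prod d (map (\<lambda>t. A (p t))
              [sum_list (take j lam) ..< sum_list (take j lam) + lam ! j]) $$ ab j))"

definition ST_is_TPI :: "'a::comm_ring_1 itself \<Rightarrow> nat \<Rightarrow> nat list \<Rightarrow> bool" where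
  "ST_is_TPI _ d lam \<longleftrightarrow>
     (\<forall>A :: nat \<Rightarrow> 'a mat. (\<forall>i < sum_list lam. A i \<in> carrier_mat d d) \<longrightarrow>
        (\<forall>ab. (\<forall>j < length lam. fst (ab j) < d \<and> snd (ab j) < d) \<longrightarrow>
           ST_eval lam d A ab = 0))"

end

theory Submission
  imports Defs "Jordan_Normal_Form.Determinant" "HOL-Library.Product_Lexorder"
    "HOL-Computational_Algebra.Formal_Power_Series"
begin

text \<open>
  Let \<open>X = (x\<^sub>i\<^sub>j)\<close> be the generic \<open>d \<times> d\<close> matrix with entries the generators of the exterior algebra
  \<open>E\<close> on \<open>d\<^sup>2\<close> letters. As \<open>ST(\<lambda>)\<close> is alternating, it is an identity for \<open>M\<^sub>d(F)\<close> iff every product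
  of entries of \<open>X\<close>-powers \<open>(X\<^sup>h\<^sup>1)\<^sub>a\<^sub>1\<^sub>b\<^sub>1 \<cdots> (X\<^sup>h\<^sup>n)\<^sub>a\<^sub>n\<^sub>b\<^sub>n\<close> with exponents the parts of \<open>\<lambda>\<close> vanishes in \<open>E\<close>.
  A nonzero product can be filled up by generators to the top degree \<open>d\<^sup>2\<close>. The top coefficient is
  then a \<open>gl\<^sub>d\<close>-invariant tensor in the indices, so some full contraction of it does not vanish. A
  contraction multiplies the factors together to a product of traces \<open>tr X\<^sup>s\<close>, where the \<open>s\<close> are the
  sums of the parts over the blocks of a set partition. Now \<open>tr X\<^sup>s = 0\<close> for even \<open>s\<close>,
  \<open>(tr X\<^sup>s)\<^sup>2 = 0\<close> for odd \<open>s\<close>, and \<open>X\<^sup>2\<^sup>d = 0\<close> (Amitsur-Levitzki), so in degree \<open>d\<^sup>2\<close> only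
  \<open>tr X \<cdot> tr X\<^sup>3 \<cdots> tr X\<^bsup>2d-1\<^esup>\<close> survives. Applied to the product of all generators this shows that
  this product of traces is nonzero. Hence \<open>ST(\<lambda>)\<close> is not an identity iff the parts of \<open>\<lambda>\<close> can be
  packed into bins of capacities \<open>1, 3, \<dots>, 2d-1\<close>. For \<open>m\<^bsup>[d;m]\<^esup> \<oplus> (m-1)\<close> this means that some
  \<open>2i-1\<close> leaves the remainder \<open>m-1\<close> modulo \<open>m\<close>.
\<close>

section \<open>The exterior algebra on the entries of a generic matrix\<close>

text \<open>The sign of the permutation that sorts the increasing word of \<open>S\<close> followed
  by that of \<open>T\<close>. For disjoint finite sets it is the structure constant in the product
  of the two basis monomials.\<close>

definition inv_sign :: "'i::linorder set \<Rightarrow> 'i set \<Rightarrow> int" where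
  "inv_sign S T = (\<Prod>s\<in>S. \<Prod>t\<in>T. if t < s then - 1 else 1)"

lemma inv_sign_empty [simp]: "inv_sign {} T = 1" "inv_sign S {} = 1"
  by (simp_all add: inv_sign_def)

lemma inv_sign_Un_left:
  assumes "finite S" "finite S'" "S \<inter> S' = {}"
  shows "inv_sign (S \<union> S') T = inv_sign S T * inv_sign S' T"
  unfolding inv_sign_def using assms by (rule prod.union_disjoint)

lemma inv_sign_Un_right:
  assumes "finite T" "finite T'" "T \<inter> T' = {}"
  shows "inv_sign S (T \<union> T') = inv_sign S T * inv_sign S T'"
  unfolding inv_sign_def prod.union_disjoint[OF assms] by (rule prod.distrib)

lemma inv_sign_swap:
  assumes "finite S" "finite T" "S \<inter> T = {}"
  shows "inv_sign T S = (- 1) ^ (card S * card T) * inv_sign S T"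
proof -
  have "inv_sign T S = (\<Prod>s\<in>S. \<Prod>t\<in>T. if s < t then - 1 else 1)"
    unfolding inv_sign_def by (rule prod.swap)
  also have "\<dots> = (\<Prod>s\<in>S. \<Prod>t\<in>T. (- 1) * (if t < s then - 1 else 1))"
    using assms(3) by (intro prod.cong refl) force
  also have "\<dots> = (- 1) ^ (card S * card T) * inv_sign S T"
    unfolding inv_sign_def prod.distrib by (simp add: power_mult[symmetric] mult.commute)
  finally show ?thesis .
qed

lemma inv_sign_cases: "inv_sign S T = 1 \<or> inv_sign S T = - 1"
proof -
  have "\<bar>inv_sign S T\<bar> = 1"
    unfolding inv_sign_def abs_prod by (intro prod.neutral ballI) auto
  then show ?thesis by linarith
qed

lemma inv_sign_nonzero [simp]: "inv_sign S T \<noteq> 0"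
  using inv_sign_cases[of S T] by auto

lemma inv_sign_square [simp]: "inv_sign S T * inv_sign S T = 1" "inv_sign S T * (inv_sign S T * x) = x"
  using inv_sign_cases[of S T] by auto

text \<open>Coefficient functions on monomials, a monomial being a finite set of index pairs ordered
  lexicographically. One type serves every \<open>d\<close>. Infinitely many coefficients may be
  nonzero, but a finite monomial has only finitely many splittings, so products make sense. Integer
  coefficients give torsion-freeness and allow sums of squares, whatever the field of the final
  statement is.\<close>

typedef exterior = "{f :: (nat \<times> nat) set \<Rightarrow> int. \<forall>S. infinite S \<longrightarrow> f S = 0}"
  morphisms coef Abs_exterior
  by (rule exI[of _ "\<lambda>_. 0"]) simp

setup_lifting type_definition_exterior

lemma coef_infinite [simp]: "infinite S \<Longrightarrow> coef f S = 0"
  by transfer blast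

lemma exterior_eqI: "(\<And>S. finite S \<Longrightarrow> coef f S = coef g S) \<Longrightarrow> f = g"
  by transfer (auto simp: fun_eq_iff, metis)

instantiation exterior :: ring_1
begin

lift_definition zero_exterior :: exterior is "\<lambda>_. 0" by simp
lift_definition one_exterior :: exterior is "\<lambda>S. if S = {} then 1 else 0" by auto
lift_definition plus_exterior :: "exterior \<Rightarrow> exterior \<Rightarrow> exterior" is "\<lambda>f g S. f S + g S" by simp
lift_definition minus_exterior :: "exterior \<Rightarrow> exterior \<Rightarrow> exterior" is "\<lambda>f g S. f S - g S" by simp
lift_definition uminus_exterior :: "exterior \<Rightarrow> exterior" is "\<lambda>f S. - f S" by simp
lift_definition times_exterior :: "exterior \<Rightarrow> exterior \<Rightarrow> exterior" is
  "\<lambda>f g S. \<Sum>T\<in>Pow S. inv_sign T (S - T) * f T * g (S - T)"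
  by (simp add: finite_Pow_iff)

text \<open>Both sides sum over the ordered splittings of \<open>S\<close> into three pieces, and
  either way the sign is the product of \<open>inv_sign\<close> over the three pairs of
  pieces.\<close>

lemma exterior_mult_assoc: "a * b * c = a * (b * (c :: exterior))"
proof (rule exterior_eqI)
  fix S :: "(nat \<times> nat) set"
  assume fin: "finite S"
  have "coef (a * b * c) S = (\<Sum>T\<in>Pow S. \<Sum>R\<in>Pow T.
      inv_sign T (S - T) * inv_sign R (T - R) * coef a R * coef b (T - R) * coef c (S - T))"
    by (simp add: times_exterior.rep_eq sum_distrib_left sum_distrib_right mult.assoc)
  also have "\<dots> = (\<Sum>(T, R)\<in>Sigma (Pow S) Pow.
      inv_sign T (S - T) * inv_sign R (T - R) * coef a R * coef b (T - R) * coef c (S - T))"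
    using fin by (intro sum.Sigma) (auto intro: finite_subset)
  also have "\<dots> = (\<Sum>(R, Q)\<in>Sigma (Pow S) (\<lambda>R. Pow (S - R)).
      inv_sign R (S - R) * inv_sign Q (S - R - Q) * coef a R * coef b Q * coef c (S - R - Q))"
  proof (rule sum.reindex_bij_witness[of _ "\<lambda>(R, Q). (R \<union> Q, R)" "\<lambda>(T, R). (R, T - R)"], goal_cases)
    case (5 x)
    obtain T R where x: "x = (T, R)" by force
    from 5 x have sub: "R \<subseteq> T" "T \<subseteq> S" by auto
    then have f: "finite R" "finite (T - R)" "finite (S - T)"
      using fin by (auto intro: finite_subset)
    have e: "S - R - (T - R) = S - T" "T = R \<union> (T - R)" "S - R = (T - R) \<union> (S - T)"
      using sub by auto
    have "inv_sign T (S - T) = inv_sign R (S - T) * inv_sign (T - R) (S - T)"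
      by (subst e(2), rule inv_sign_Un_left) (use f in auto)
    moreover have "inv_sign R (S - R) = inv_sign R (T - R) * inv_sign R (S - T)"
      by (subst e(3), rule inv_sign_Un_right) (use f sub in auto)
    ultimately show ?case by (simp add: x e(1) mult_ac)
  qed auto
  also have "\<dots> = (\<Sum>R\<in>Pow S. \<Sum>Q\<in>Pow (S - R).
      inv_sign R (S - R) * inv_sign Q (S - R - Q) * coef a R * coef b Q * coef c (S - R - Q))"
    using fin by (intro sum.Sigma[symmetric]) auto
  also have "\<dots> = coef (a * (b * c)) S"
    by (simp add: times_exterior.rep_eq sum_distrib_left sum_distrib_right mult_ac)
  finally show "coef (a * b * c) S = coef (a * (b * c)) S" .
qed

instance
proof
  fix a b c :: exterior
  show "a * b * c = a * (b * c)" by (rule exterior_mult_assoc)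
  show "1 * a = a"
  proof (rule exterior_eqI)
    fix S :: "(nat \<times> nat) set" assume "finite S"
    then show "coef (1 * a) S = coef a S"
      unfolding times_exterior.rep_eq one_exterior.rep_eq
      by (subst sum.mono_neutral_right[of _ "{{}}"]) auto
  qed
  show "a * 1 = a"
  proof (rule exterior_eqI)
    fix S :: "(nat \<times> nat) set" assume fin: "finite S"
    have "coef (a * 1) S = (\<Sum>T\<in>{S}. inv_sign T (S - T) * coef a T * coef 1 (S - T))"
      unfolding times_exterior.rep_eq using fin
      by (intro sum.mono_neutral_right) (auto simp: one_exterior.rep_eq)
    then show "coef (a * 1) S = coef a S" by (simp add: one_exterior.rep_eq)
  qed
  show "(a + b) * c = a * c + b * c" "a * (b + c) = a * b + a * c"
    by (rule exterior_eqI; simp add: times_exterior.rep_eq plus_exterior.rep_eq algebra_simps sum.distrib)+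
  show "(0::exterior) \<noteq> 1" by transfer (auto simp: fun_eq_iff)
qed (transfer; simp add: fun_eq_iff)+

end

lemmas coef_simps [simp] =
  zero_exterior.rep_eq plus_exterior.rep_eq minus_exterior.rep_eq uminus_exterior.rep_eq

lemma coef_sum: "coef (sum f A) S = (\<Sum>x\<in>A. coef (f x) S)"
  by (induction A rule: infinite_finite_induct) simp_all

lemma coef_of_nat_mult: "coef (of_nat n * f) S = of_nat n * coef f S"
  by (induction n) (simp_all add: distrib_right)

section \<open>Generators, contractions and derivations\<close>

lift_definition gen :: "nat \<times> nat \<Rightarrow> exterior" is "\<lambda>c S. if S = {c} then 1 else 0" by auto

text \<open>The interior product with the covector dual to the generator \<open>c\<close>: it moves
  \<open>c\<close> to the front of a monomial and deletes it there.\<close>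

lift_definition contract :: "nat \<times> nat \<Rightarrow> exterior \<Rightarrow> exterior" is
  "\<lambda>c f S. if c \<in> S then 0 else inv_sign {c} S * f (insert c S)" by simp

lift_definition grade_inv :: "exterior \<Rightarrow> exterior" is "\<lambda>f S. (- 1) ^ card S * f S" by simp

lemma coef_gen_mult:
  "coef (gen c * f) S = (if c \<in> S then inv_sign {c} (S - {c}) * coef f (S - {c}) else 0)"
proof (cases "finite S")
  case True
  have "coef (gen c * f) S = (\<Sum>T\<in>(if c \<in> S then {{c}} else {}). inv_sign T (S - T) * coef (gen c) T * coef f (S - T))"
    unfolding times_exterior.rep_eq using True
    by (intro sum.mono_neutral_right) (auto simp: gen.rep_eq split: if_splits)
  then show ?thesis by (simp add: gen.rep_eq)
qed simp

lemma coef_mult_gen: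
  "coef (f * gen c) S = (if c \<in> S then inv_sign (S - {c}) {c} * coef f (S - {c}) else 0)"
proof (cases "finite S")
  case True
  have "coef (f * gen c) S = (\<Sum>T\<in>(if c \<in> S then {S - {c}} else {}). inv_sign T (S - T) * coef f T * coef (gen c) (S - T))"
    unfolding times_exterior.rep_eq using True
    by (intro sum.mono_neutral_right) (auto simp: gen.rep_eq split: if_splits)
  moreover have "S - (S - {c}) = {c}" if "c \<in> S" using that by auto
  ultimately show ?thesis by (simp add: gen.rep_eq)
qed simp

lemma gen_commute: "gen c * f = grade_inv f * gen c"
proof (rule exterior_eqI)
  fix S :: "(nat \<times> nat) set" assume "finite S"
  then show "coef (gen c * f) S = coef (grade_inv f * gen c) S"
    using inv_sign_swap[of "S - {c}" "{c}"]
    by (simp add: coef_gen_mult coef_mult_gen grade_inv.rep_eq)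
qed

lemma sum_Pow_insert:
  assumes "finite S" "c \<notin> S"
  shows "(\<Sum>T\<in>Pow (insert c S). F T) = (\<Sum>T\<in>Pow S. F T + F (insert c T))"
proof -
  have "inj_on (insert c) (Pow S)" using assms(2) by (auto simp: inj_on_def)
  moreover have "Pow S \<inter> insert c ` Pow S = {}" using assms(2) by auto
  ultimately show ?thesis
    using assms(1) by (simp add: Pow_insert sum.union_disjoint sum.reindex sum.distrib)
qed

text \<open>The antiderivation law. At a monomial that contains \<open>c\<close> the left side has
  coefficient 0, and on the right the splittings cancel in pairs according to the side on which
  \<open>c\<close> lies. At other monomials the splittings of \<open>insert c S\<close> are sorted
  by the side of \<open>c\<close>.\<close>

lemma contract_mult: "contract c (f * g) = contract c f * g + grade_inv f * contract c g"
proof (rule exterior_eqI)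
  fix S :: "(nat \<times> nat) set" assume fin: "finite S"
  have sgn: "inv_sign T {c} = (- 1) ^ card T * inv_sign {c} T" if "T \<subseteq> S" "c \<notin> T" for T
    using inv_sign_swap[of "{c}" T] that fin by (auto intro: finite_subset)
  show "coef (contract c (f * g)) S = coef (contract c f * g + grade_inv f * contract c g) S"
  proof (cases "c \<in> S")
    case True
    define S' where "S' = S - {c}"
    have S: "S = insert c S'" "c \<notin> S'" "finite S'" using True fin by (auto simp: S'_def)
    have "coef (contract c f * g + grade_inv f * contract c g) S =
      (\<Sum>T\<in>Pow S. inv_sign T (S - T) * coef (contract c f) T * coef g (S - T)
        + inv_sign T (S - T) * coef (grade_inv f) T * coef (contract c g) (S - T))"
      by (simp add: times_exterior.rep_eq sum.distrib)
    also have "\<dots> = 0"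
      unfolding S(1) sum_Pow_insert[OF S(3,2)]
    proof (rule sum.neutral, rule ballI, goal_cases)
      case (1 T)
      have f: "finite T" "finite (S' - T)" "c \<notin> T" "c \<notin> S' - T" "T \<subseteq> S"
        using 1 S by (auto intro: finite_subset)
      have d: "insert c S' - T = insert c (S' - T)" "insert c S' - insert c T = S' - T"
        "insert c (S' - T) = {c} \<union> (S' - T)" "insert c T = {c} \<union> T"
        using f S by auto
      have "inv_sign T (insert c S' - T) = inv_sign T {c} * inv_sign T (S' - T)"
        unfolding d by (rule inv_sign_Un_right) (use f in auto)
      moreover have "inv_sign (insert c T) (S' - T) = inv_sign {c} (S' - T) * inv_sign T (S' - T)"
        unfolding d by (rule inv_sign_Un_left) (use f in auto)
      ultimately show ?case
        using f by (simp add: d(1,2) contract.rep_eq grade_inv.rep_eq sgn mult_ac)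
    qed
    finally show ?thesis using True by (simp add: contract.rep_eq)
  next
    case False
    have "coef (contract c (f * g)) S = (\<Sum>T\<in>Pow S.
       inv_sign {c} S * (inv_sign T (insert c S - T) * coef f T * coef g (insert c S - T)
       + inv_sign (insert c T) (insert c S - insert c T) * coef f (insert c T) * coef g (insert c S - insert c T)))"
      using False fin by (simp add: contract.rep_eq times_exterior.rep_eq sum_Pow_insert sum_distrib_left)
    also have "\<dots> = (\<Sum>T\<in>Pow S. inv_sign T (S - T) * coef (contract c f) T * coef g (S - T)
        + inv_sign T (S - T) * coef (grade_inv f) T * coef (contract c g) (S - T))"
    proof (rule sum.cong[OF refl], goal_cases)
      case (1 T)
      have f: "finite T" "finite (S - T)" "c \<notin> T" "c \<notin> S - T" "T \<subseteq> S"
        using 1 False fin by (auto intro: finite_subset)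
      have d: "insert c S - T = insert c (S - T)" "insert c S - insert c T = S - T"
        "insert c (S - T) = {c} \<union> (S - T)" "insert c T = {c} \<union> T" "S = T \<union> (S - T)"
        using f False by auto
      have "inv_sign T (insert c S - T) = inv_sign T {c} * inv_sign T (S - T)"
        unfolding d(1,3) by (rule inv_sign_Un_right) (use f in auto)
      moreover have "inv_sign (insert c T) (S - T) = inv_sign {c} (S - T) * inv_sign T (S - T)"
        unfolding d(4) by (rule inv_sign_Un_left) (use f in auto)
      moreover have "inv_sign {c} S = inv_sign {c} T * inv_sign {c} (S - T)"
        by (subst d(5), rule inv_sign_Un_right) (use f in auto)
      ultimately show ?case
        using f by (simp add: d(1,2) contract.rep_eq grade_inv.rep_eq sgn algebra_simps)
    qed
    also have "\<dots> = coef (contract c f * g + grade_inv f * contract c g) S"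
      by (simp add: times_exterior.rep_eq sum.distrib)
    finally show ?thesis .
  qed
qed

lemma contract_simps [simp]:
  "contract c 0 = 0" "contract c (f + g) = contract c f + contract c g"
  "contract c (f - g) = contract c f - contract c g" "contract c (- f) = - contract c f"
  by (rule exterior_eqI; simp add: contract.rep_eq algebra_simps)+

lemma contract_1 [simp]: "contract c 1 = 0"
  by (rule exterior_eqI) (simp add: contract.rep_eq one_exterior.rep_eq)

lemma contract_gen [simp]: "contract c (gen e) = (if c = e then 1 else 0)"
proof (rule exterior_eqI)
  fix S :: "(nat \<times> nat) set"
  have "insert c S = {e} \<longleftrightarrow> c = e \<and> S = {}" if "c \<notin> S" using that by auto
  then show "coef (contract c (gen e)) S = coef (if c = e then 1 else 0) S"
    by (auto simp: contract.rep_eq one_exterior.rep_eq gen.rep_eq)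
qed

lemma grade_inv_simps [simp]:
  "grade_inv 0 = 0" "grade_inv (f + g) = grade_inv f + grade_inv g" "grade_inv (- f) = - grade_inv f"
  by (rule exterior_eqI; simp add: grade_inv.rep_eq algebra_simps)+

text \<open>The derivation that replaces the generator \<open>c\<close> by \<open>a\<close> and kills all other generators.\<close>

definition replace_gen :: "nat \<times> nat \<Rightarrow> nat \<times> nat \<Rightarrow> exterior \<Rightarrow> exterior" where
  "replace_gen c a f = gen a * contract c f"

text \<open>Contraction obeys the Leibniz rule up to the grading sign; multiplication by the odd
  element \<open>gen a\<close> absorbs that sign, which leaves a true derivation.\<close>

lemma replace_gen_mult: "replace_gen c a (f * g) = replace_gen c a f * g + f * replace_gen c a g"
proof -
  have "gen a * grade_inv f = f * gen a"
    by (rule exterior_eqI) (simp add: gen_commute grade_inv.rep_eq coef_mult_gen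
      mult.assoc[symmetric] power_mult_distrib[symmetric])
  then show ?thesis
    unfolding replace_gen_def contract_mult distrib_left mult.assoc[symmetric] by simp
qed

lemma replace_gen_simps [simp]:
  "replace_gen c a 0 = 0" "replace_gen c a 1 = 0"
  "replace_gen c a (f + g) = replace_gen c a f + replace_gen c a g"
  "replace_gen c a (f - g) = replace_gen c a f - replace_gen c a g"
  "replace_gen c a (- f) = - replace_gen c a f"
  "replace_gen c a (gen e) = (if c = e then gen a else 0)"
  by (simp_all add: replace_gen_def distrib_left right_diff_distrib)

text \<open>Replacing \<open>c\<close> by a different generator \<open>a\<close> leaves only
  monomials without \<open>c\<close>, so nothing reaches a monomial that contains both.\<close>

lemma coef_replace_gen:
  assumes "a \<in> S" "c \<in> S"
  shows "coef (replace_gen c a f) S = (if c = a then coef f S else 0)"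
  using assms by (cases "finite S") (auto simp: replace_gen_def coef_gen_mult contract.rep_eq insert_absorb)

section \<open>Homogeneous elements and graded commutativity\<close>

definition homog :: "nat \<Rightarrow> nat \<Rightarrow> exterior \<Rightarrow> bool" where
  "homog d n f \<longleftrightarrow> (\<forall>S. coef f S \<noteq> 0 \<longrightarrow> S \<subseteq> {..<d} \<times> {..<d} \<and> card S = n)"

lemma homog_0 [simp]: "homog d n 0" by (simp add: homog_def)

lemma homog_1 [simp]: "homog d 0 1" by (auto simp: homog_def one_exterior.rep_eq split: if_splits)

lemma homog_gen: "a < d \<Longrightarrow> b < d \<Longrightarrow> homog d 1 (gen (a, b))"
  by (auto simp: homog_def gen.rep_eq split: if_splits)

lemma homog_add: "homog d n f \<Longrightarrow> homog d n g \<Longrightarrow> homog d n (f + g)"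
  unfolding homog_def by (simp, metis add_0)

lemma homog_sum: "(\<And>x. x \<in> A \<Longrightarrow> homog d n (f x)) \<Longrightarrow> homog d n (sum f A)"
  by (induction A rule: infinite_finite_induct) (auto intro: homog_add)

lemma coef_mult_nonzeroE:
  assumes "coef (f * g) S \<noteq> 0"
  obtains T where "T \<subseteq> S" "coef f T \<noteq> 0" "coef g (S - T) \<noteq> 0" "card S = card T + card (S - T)"
proof -
  from assms have fin: "finite S" by (metis coef_infinite)
  from assms obtain T where "T \<in> Pow S" "inv_sign T (S - T) * coef f T * coef g (S - T) \<noteq> 0"
    unfolding times_exterior.rep_eq by (rule sum.not_neutral_contains_not_neutral)
  moreover from this have "card S = card T + card (S - T)"
    using fin card_mono[OF fin, of T] by (auto simp: card_Diff_subset finite_subset)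
  ultimately show thesis using that by auto
qed

text \<open>Only the parity of the product of the degrees matters. In this form the lemma covers
  homogeneous factors as well as, with \<open>k\<close> = 0, factors that merely have even
  degrees.\<close>

lemma mult_commute_sign:
  assumes "\<And>T U. coef f T \<noteq> 0 \<Longrightarrow> coef g U \<noteq> 0 \<Longrightarrow> (- 1) ^ (card T * card U) = ((- 1) ^ k :: int)"
  shows "g * f = (- 1) ^ k * (f * g)"
proof (rule exterior_eqI)
  fix S :: "(nat \<times> nat) set" assume fin: "finite S"
  have pw: "coef ((- 1) ^ k * h) S = (- 1) ^ k * coef h S" for k h
    by (induction k) (simp_all add: mult.assoc)
  have "coef (g * f) S = (\<Sum>T\<in>Pow S. inv_sign (S - T) T * coef g (S - T) * coef f T)"
    unfolding times_exterior.rep_eq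
    by (rule sum.reindex_bij_witness[of _ "\<lambda>T. S - T" "\<lambda>T. S - T"]) (auto simp: double_diff)
  also have "\<dots> = (\<Sum>T\<in>Pow S. (- 1) ^ k * (inv_sign T (S - T) * coef f T * coef g (S - T)))"
  proof (rule sum.cong[OF refl])
    fix T assume T: "T \<in> Pow S"
    show "inv_sign (S - T) T * coef g (S - T) * coef f T =
        (- 1) ^ k * (inv_sign T (S - T) * coef f T * coef g (S - T))"
    proof (cases "coef f T = 0 \<or> coef g (S - T) = 0")
      case False
      then have "(- 1) ^ (card T * card (S - T)) = ((- 1) ^ k :: int)" using assms by blast
      then show ?thesis
        using inv_sign_swap[of T "S - T"] T fin by (simp add: finite_subset mult_ac)
    qed auto
  qed
  also have "\<dots> = coef ((- 1) ^ k * (f * g)) S"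
    unfolding pw by (simp add: times_exterior.rep_eq sum_distrib_left)
  finally show "coef (g * f) S = coef ((- 1) ^ k * (f * g)) S" .
qed

lemma homog_mult:
  assumes "homog d m f" "homog d n g"
  shows "homog d (m + n) (f * g)"
  unfolding homog_def
proof (intro allI impI)
  fix S assume "coef (f * g) S \<noteq> 0"
  then obtain T where "T \<subseteq> S" "coef f T \<noteq> 0" "coef g (S - T) \<noteq> 0" "card S = card T + card (S - T)"
    by (rule coef_mult_nonzeroE)
  moreover from this assms have "T \<subseteq> {..<d} \<times> {..<d}" "card T = m" "S - T \<subseteq> {..<d} \<times> {..<d}" "card (S - T) = n"
    unfolding homog_def by blast+
  ultimately show "S \<subseteq> {..<d} \<times> {..<d} \<and> card S = m + n" by auto
qed

lemma homog_commute:
  assumes "homog d m f" "homog d n g"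
  shows "g * f = (- 1) ^ (m * n) * (f * g)"
proof (rule mult_commute_sign)
  fix T U assume "coef f T \<noteq> 0" "coef g U \<noteq> 0"
  then have "card T = m" "card U = n" using assms unfolding homog_def by blast+
  then show "(- 1) ^ (card T * card U) = ((- 1) ^ (m * n) :: int)" by simp
qed

lemma homog_degree_le:
  assumes "homog d n f" "f \<noteq> 0"
  shows "n \<le> d\<^sup>2"
proof -
  obtain S where "coef f S \<noteq> 0" using assms(2) exterior_eqI[of f 0] by auto
  with assms(1) have "S \<subseteq> {..<d} \<times> {..<d}" "card S = n" by (auto simp: homog_def)
  then show ?thesis using card_mono[of "{..<d} \<times> {..<d}" S] by (simp add: power2_eq_square card_cartesian_product)
qed

lemma homog_top_eq_0_iff:
  assumes "homog d (d\<^sup>2) f"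
  shows "f = 0 \<longleftrightarrow> coef f ({..<d} \<times> {..<d}) = 0"
proof
  assume z: "coef f ({..<d} \<times> {..<d}) = 0"
  show "f = 0"
  proof (rule exterior_eqI)
    fix S
    have "S = {..<d} \<times> {..<d}" if "coef f S \<noteq> 0"
      by (rule card_subset_eq) (use that assms in \<open>auto simp: homog_def power2_eq_square card_cartesian_product\<close>)
    then show "coef f S = coef 0 S" using z by auto
  qed
qed simp

text \<open>A monomial occurring in \<open>f\<close> below the top degree misses some generator, and
  multiplication by that generator preserves its coefficient up to sign.\<close>

lemma ex_gen_mult_nonzero:
  assumes "homog d n f" "f \<noteq> 0" "n < d\<^sup>2"
  shows "\<exists>a<d. \<exists>b<d. f * gen (a, b) \<noteq> 0"
proof -
  obtain S where S: "coef f S \<noteq> 0" using assms(2) exterior_eqI[of f 0] by auto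
  with assms(1) have "S \<subseteq> {..<d} \<times> {..<d}" "card S = n" by (auto simp: homog_def)
  with assms(3) have "S \<noteq> {..<d} \<times> {..<d}" by (auto simp: power2_eq_square card_cartesian_product)
  then obtain a b where ab: "a < d" "b < d" "(a, b) \<notin> S" using \<open>S \<subseteq> _\<close> by auto
  then have "coef (f * gen (a, b)) (insert (a, b) S) \<noteq> 0"
    using S by (simp add: coef_mult_gen)
  then have "f * gen (a, b) \<noteq> 0" by auto
  with ab show ?thesis by blast
qed

section \<open>Powers of the generic matrix and the Amitsur-Levitzki theorem\<close>

unbundle fps_syntax
no_notation vec_index (infixl "$" 100)

lemma fps_deriv_prod:
  fixes f :: "'i \<Rightarrow> 'a::comm_ring_1 fps"
  assumes "finite S"
  shows "fps_deriv (\<Prod>i\<in>S. f i) = (\<Sum>i\<in>S. fps_deriv (f i) * (\<Prod>j\<in>S - {i}. f j))"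
  using assms
proof (induction S)
  case empty
  show ?case using fps_deriv_const[of 1] by simp
next
  case (insert k S)
  have "(\<Sum>i\<in>S. fps_deriv (f i) * (\<Prod>j\<in>insert k S - {i}. f j)) =
      f k * (\<Sum>i\<in>S. fps_deriv (f i) * (\<Prod>j\<in>S - {i}. f j))"
    unfolding sum_distrib_left
  proof (rule sum.cong[OF refl])
    fix i assume "i \<in> S"
    then have "insert k S - {i} = insert k (S - {i})" using insert by auto
    then show "fps_deriv (f i) * (\<Prod>j\<in>insert k S - {i}. f j) = f k * (fps_deriv (f i) * (\<Prod>j\<in>S - {i}. f j))"
      using insert by (simp add: mult_ac)
  qed
  with insert show ?case by simp
qed

text \<open>Jacobi's formula. The Leibniz rule gives a sum of determinants \<open>det (R i)\<close>
  in which only row \<open>i\<close> is differentiated; expanding along that row meets the cofactors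
  of \<open>M\<close> itself.\<close>

lemma fps_deriv_det:
  fixes M :: "'a::comm_ring_1 fps mat"
  assumes M: "M \<in> carrier_mat n n"
  shows "fps_deriv (det M) = (\<Sum>i<n. \<Sum>j<n. fps_deriv (M $$ (i, j)) * cofactor M i j)"
proof -
  define R where "R i = mat n n (\<lambda>(k, j). if k = i then fps_deriv (M $$ (i, j)) else M $$ (k, j))" for i
  have sgn: "fps_deriv (signof p * x) = signof p * fps_deriv x" for p and x :: "'a fps"
    by (cases p rule: sign_cases) simp_all
  have "fps_deriv (det M) = (\<Sum>p | p permutes {0..<n}. \<Sum>i<n.
      signof p * (fps_deriv (M $$ (i, p i)) * (\<Prod>k\<in>{0..<n} - {i}. M $$ (k, p k))))"
    unfolding det_def'[OF M] fps_deriv_sum sgn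
    by (simp add: fps_deriv_prod sum_distrib_left atLeast0LessThan)
  also have "\<dots> = (\<Sum>i<n. \<Sum>p | p permutes {0..<n}.
      signof p * (fps_deriv (M $$ (i, p i)) * (\<Prod>k\<in>{0..<n} - {i}. M $$ (k, p k))))"
    by (rule sum.swap)
  also have "\<dots> = (\<Sum>i<n. det (R i))"
  proof (rule sum.cong[OF refl])
    fix i assume "i \<in> {..<n}"
    then have i: "i < n" by simp
    have "signof p * (fps_deriv (M $$ (i, p i)) * (\<Prod>k\<in>{0..<n} - {i}. M $$ (k, p k))) =
        signof p * (\<Prod>k = 0..<n. R i $$ (k, p k))" if p: "p permutes {0..<n}" for p
    proof -
      have pk: "p k < n" if "k < n" for k using permutes_in_image[OF p, of k] that by simp
      have "(\<Prod>k = 0..<n. R i $$ (k, p k)) = R i $$ (i, p i) * (\<Prod>k\<in>{0..<n} - {i}. R i $$ (k, p k))"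
        using i by (intro prod.remove) auto
      also have "(\<Prod>k\<in>{0..<n} - {i}. R i $$ (k, p k)) = (\<Prod>k\<in>{0..<n} - {i}. M $$ (k, p k))"
        using pk by (intro prod.cong) (auto simp: R_def)
      finally show ?thesis using i pk by (simp add: R_def)
    qed
    then show "(\<Sum>p | p permutes {0..<n}. signof p * (fps_deriv (M $$ (i, p i)) *
        (\<Prod>k\<in>{0..<n} - {i}. M $$ (k, p k)))) = det (R i)"
      by (subst det_def'[of _ n]) (auto simp: R_def intro!: sum.cong)
  qed
  also have "\<dots> = (\<Sum>i<n. \<Sum>j<n. fps_deriv (M $$ (i, j)) * cofactor M i j)"
  proof (rule sum.cong[OF refl])
    fix i assume "i \<in> {..<n}"
    then have i: "i < n" by simp
    have "mat_delete (R i) i j = mat_delete M i j" for j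
      by (rule eq_matI) (use i M in \<open>auto simp: mat_delete_def R_def\<close>)
    then have "cofactor (R i) i j = cofactor M i j" for j by (simp add: cofactor_def)
    moreover have "det (R i) = (\<Sum>j<n. R i $$ (i, j) * cofactor (R i) i j)"
      by (rule laplace_expansion_row) (use i in \<open>auto simp: R_def\<close>)
    ultimately show "det (R i) = (\<Sum>j<n. fps_deriv (M $$ (i, j)) * cofactor M i j)"
      using i by (simp add: R_def)
  qed
  finally show ?thesis .
qed

text \<open>Bounds the degree of the minors of 1 - t Y, whose entries have degree at most one in
  t.\<close>

lemma prod_linear_fps_nth_eq_0:
  fixes f :: "'i \<Rightarrow> 'a::comm_ring_1 fps"
  assumes "finite S" "\<And>i n. i \<in> S \<Longrightarrow> 1 < n \<Longrightarrow> f i $ n = 0" "card S < n"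
  shows "(\<Prod>i\<in>S. f i) $ n = 0"
  using assms
proof (induction S arbitrary: n rule: finite_induct)
  case (insert k S)
  have "f k $ l * (\<Prod>i\<in>S. f i) $ (n - l) = 0" if "l \<le> n" for l
  proof (cases "1 < l")
    case False
    then have "(\<Prod>i\<in>S. f i) $ (n - l) = 0" using insert by (intro insert.IH) auto
    then show ?thesis by simp
  qed (use insert in simp)
  then show ?case using insert by (simp add: fps_mult_nth)
qed simp

lemma fps_nth_0_hom: "comm_ring_hom (\<lambda>f :: 'a::comm_ring_1 fps. f $ 0)"
  by unfold_locales simp_all

text \<open>With \<open>D(t) = det (1 - t Y)\<close>, the vanishing of the traces of all powers of \<open>Y\<close> gives
  \<open>D' = 0\<close>, so \<open>D = 1\<close> and the adjugate of \<open>1 - t Y\<close> is \<open>\<Sum>n. t\<^sup>n Y\<^sup>n\<close>. Its entries are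
  polynomials of degree less than \<open>d\<close>.\<close>

lemma matrix_power_eq_0_of_traces:
  fixes Y :: "nat \<Rightarrow> nat \<Rightarrow> 'a::comm_ring_1" and P :: "nat \<Rightarrow> nat \<Rightarrow> nat \<Rightarrow> 'a"
  assumes P0: "\<And>i j. i < d \<Longrightarrow> j < d \<Longrightarrow> P 0 i j = (if i = j then 1 else 0)"
    and P_Suc: "\<And>n i j. i < d \<Longrightarrow> j < d \<Longrightarrow> P (Suc n) i j = (\<Sum>k<d. P n i k * Y k j)"
    and traces: "\<And>n. (\<Sum>i<d. P (Suc n) i i) = 0"
    and torsion_free: "\<And>n (x::'a). 0 < n \<Longrightarrow> of_nat n * x = 0 \<Longrightarrow> x = 0"
    and ij: "i < d" "j < d"
  shows "P d i j = 0"
proof -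
  define M where "M = mat d d (\<lambda>(i, j). (if i = j then 1 else 0) - fps_X * fps_const (Y i j))"
  have M: "M \<in> carrier_mat d d" by (simp add: M_def)
  define D where "D = det M"
  \<comment> \<open>\<open>B\<close> is the adjugate of \<open>M\<close> = 1 - t Y, hence the
    swapped indices.\<close>
  define B where "B = (\<lambda>i j. cofactor M j i)"
  have BM: "(\<Sum>k<d. B i k * M $$ (k, j)) = (if i = j then D else 0)" if "i < d" "j < d" for i j
  proof -
    have "(adj_mat M * M) $$ (i, j) = (\<Sum>k<d. B i k * M $$ (k, j))"
      using that M by (simp add: adj_mat_def scalar_prod_def B_def atLeast0LessThan)
    then show ?thesis using adj_mat(3)[OF M] that by (cases "i = j") (simp_all add: D_def)
  qed
  have rec: "B i j = (if i = j then D else 0) + fps_X * (\<Sum>k<d. B i k * fps_const (Y k j))" if "i < d" "j < d" for i j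
  proof -
    have "(\<Sum>k<d. B i k * M $$ (k, j)) = (\<Sum>k<d. (if k = j then B i k else 0) - fps_X * (B i k * fps_const (Y k j)))"
      using that by (intro sum.cong) (auto simp: M_def algebra_simps)
    also have "\<dots> = B i j - fps_X * (\<Sum>k<d. B i k * fps_const (Y k j))"
      using that by (simp add: sum_subtractf sum_distrib_left)
    finally show ?thesis using BM[OF that] by (simp add: algebra_simps)
  qed
  have B_Suc: "B i j $ Suc n = (if i = j then D $ Suc n else 0) + (\<Sum>k<d. B i k $ n * Y k j)"
    if "i < d" "j < d" for i j n
    by (subst rec[OF that]) (simp add: fps_sum_nth)
  have B_0: "B i j $ 0 = (if i = j then D $ 0 else 0)" if "i < d" "j < d" for i j
    by (subst rec[OF that]) simp
  \<comment> \<open>The recursion \<open>rec\<close> reads B = D + t B Y with the scalar matrix D;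
    its solution is D times the geometric series in t Y.\<close>
  have B: "B i j $ n = (\<Sum>l\<le>n. D $ l * P (n - l) i j)" if "i < d" "j < d" for i j n
    using that(2)
  proof (induction n arbitrary: j)
    case 0
    then show ?case using that by (simp add: B_0 P0)
  next
    case (Suc n)
    have "(\<Sum>k<d. B i k $ n * Y k j) = (\<Sum>k<d. \<Sum>l\<le>n. D $ l * (P (n - l) i k * Y k j))"
      by (intro sum.cong refl) (simp add: Suc.IH sum_distrib_right mult.assoc)
    also have "\<dots> = (\<Sum>l\<le>n. D $ l * P (Suc (n - l)) i j)"
      by (subst sum.swap) (simp add: P_Suc that Suc.prems sum_distrib_left)
    also have "\<dots> = (\<Sum>l\<le>n. D $ l * P (Suc n - l) i j)"
      by (intro sum.cong refl) (simp add: Suc_diff_le)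
    finally show ?case using that Suc.prems by (simp add: B_Suc P0 add.commute)
  qed
  \<comment> \<open>By Jacobi's formula D' is the negative of tr (B Y), a combination of traces of
    positive powers of Y, all of which vanish. The factor \<open>Suc n\<close> is cancelled by
    \<open>torsion_free\<close>.\<close>
  have D_Suc: "D $ Suc n = 0" for n
  proof -
    have "fps_deriv D = (\<Sum>i<d. \<Sum>j<d. - fps_const (Y i j) * B j i)"
      unfolding D_def fps_deriv_det[OF M] B_def by (intro sum.cong refl) (simp add: M_def)
    then have "of_nat (Suc n) * D $ Suc n = (\<Sum>i<d. \<Sum>j<d. - fps_const (Y i j) * B j i) $ n"
      by (metis fps_deriv_nth Suc_eq_plus1)
    also have "\<dots> = - (\<Sum>i<d. \<Sum>j<d. B j i $ n * Y i j)"
      by (simp add: fps_sum_nth sum_negf mult.commute)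
    also have "(\<Sum>i<d. \<Sum>j<d. B j i $ n * Y i j) = (\<Sum>j<d. \<Sum>i<d. \<Sum>l\<le>n. D $ l * (P (n - l) j i * Y i j))"
      by (subst sum.swap) (simp add: B sum_distrib_right mult.assoc)
    also have "\<dots> = (\<Sum>j<d. \<Sum>l\<le>n. D $ l * P (Suc (n - l)) j j)"
      by (rule sum.cong[OF refl], subst sum.swap) (simp add: P_Suc sum_distrib_left)
    also have "\<dots> = (\<Sum>l\<le>n. D $ l * (\<Sum>j<d. P (Suc (n - l)) j j))"
      by (subst sum.swap) (simp add: sum_distrib_left)
    finally show ?thesis using torsion_free[of "Suc n" "D $ Suc n"] by (simp add: traces del: of_nat_Suc)
  qed
  interpret h: comm_ring_hom "\<lambda>f :: 'a fps. f $ 0" by (rule fps_nth_0_hom)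
  have "map_mat (\<lambda>f. f $ 0) M = 1\<^sub>m d" by (rule eq_matI) (auto simp: M_def)
  then have D_0: "D $ 0 = 1" unfolding D_def h.hom_det[symmetric] by simp
  have "B i j $ d = (\<Sum>l\<in>{0}. D $ l * P (d - l) i j)"
    unfolding B[OF ij]
  proof (rule sum.mono_neutral_right)
    show "\<forall>l\<in>{..d} - {0}. D $ l * P (d - l) i j = 0"
      using D_Suc by (metis DiffD2 insertI1 mult_zero_left old.nat.exhaust)
  qed auto
  then have "P d i j = B i j $ d" by (simp add: D_0)
  also have "\<dots> = 0"
  proof -
    define C where "C = mat_delete M j i"
    have C: "C \<in> carrier_mat (d - 1) (d - 1)" using mat_delete_carrier[OF M] by (simp add: C_def)
    have lin: "C $$ (k, l) $ n = 0" if "k < d - 1" "l < d - 1" "1 < n" for k l n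
      using that by (auto simp: C_def mat_delete_def M_def fps_X_mult_nth)
    have "(\<Prod>k = 0..<d - 1. C $$ (k, p k)) $ d = 0" if p: "p permutes {0..<d - 1}" for p
      using lin permutes_in_image[OF p] ij by (intro prod_linear_fps_nth_eq_0) auto
    moreover have "(signof p * x) $ d = signof p * x $ d" for p and x :: "'a fps"
      by (cases p rule: sign_cases) simp_all
    ultimately have "det C $ d = 0" unfolding det_def'[OF C] by (simp add: fps_sum_nth)
    moreover have "((- 1) ^ n * x) $ d = (- 1) ^ n * x $ d" for n and x :: "'a fps"
      by (induction n) simp_all
    ultimately show ?thesis by (simp add: B_def cofactor_def C_def)
  qed
  finally show ?thesis .
qed

text \<open>Elements of even degree commute. This subalgebra is made a type so that the result on
  matrices over commutative rings applies to the square of the generic matrix.\<close>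

typedef even_exterior = "{f. \<forall>S. coef f S \<noteq> 0 \<longrightarrow> even (card S)}"
  morphisms of_even Abs_even_exterior
  by (rule exI[of _ 0]) simp

setup_lifting type_definition_even_exterior

instantiation even_exterior :: comm_ring_1
begin

lift_definition zero_even_exterior :: even_exterior is 0 by simp
lift_definition one_even_exterior :: even_exterior is 1
  by (auto simp: one_exterior.rep_eq split: if_splits)
lift_definition plus_even_exterior :: "even_exterior \<Rightarrow> even_exterior \<Rightarrow> even_exterior" is "(+)"
  by (simp, metis add_0)
lift_definition minus_even_exterior :: "even_exterior \<Rightarrow> even_exterior \<Rightarrow> even_exterior" is "(-)"
  by (simp, metis)
lift_definition uminus_even_exterior :: "even_exterior \<Rightarrow> even_exterior" is uminus by simp
lift_definition times_even_exterior :: "even_exterior \<Rightarrow> even_exterior \<Rightarrow> even_exterior" is "(*)"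
  by (elim coef_mult_nonzeroE) simp

instance
proof
  fix a b c :: even_exterior
  show "a * b = b * a"
    by transfer (rule mult_commute_sign[of _ _ 0, simplified], simp)
  show "(0 :: even_exterior) \<noteq> 1" by transfer simp
qed (transfer; simp add: algebra_simps)+

end

section \<open>Entries and traces of powers of the generic matrix\<close>

fun gen_pow :: "nat \<Rightarrow> nat \<Rightarrow> nat \<Rightarrow> nat \<Rightarrow> exterior" where
  "gen_pow d 0 a b = (if a = b then 1 else 0)"
| "gen_pow d (Suc h) a b = (\<Sum>c<d. gen (a, c) * gen_pow d h c b)"

lemma gen_pow_add:
  assumes "a < d"
  shows "gen_pow d (h + k) a b = (\<Sum>c<d. gen_pow d h a c * gen_pow d k c b)"
  using assms
proof (induction h arbitrary: a)
  case 0
  then show ?case by (simp add: if_distrib if_distribR cong: if_cong)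
next
  case (Suc h)
  have "gen_pow d (Suc h + k) a b = (\<Sum>e<d. \<Sum>c<d. gen (a, e) * gen_pow d h e c * gen_pow d k c b)"
    by (simp add: Suc.IH sum_distrib_left mult.assoc)
  also have "\<dots> = (\<Sum>c<d. gen_pow d (Suc h) a c * gen_pow d k c b)"
    by (subst sum.swap) (simp add: sum_distrib_right)
  finally show ?case .
qed

lemma gen_pow_1: "b < d \<Longrightarrow> gen_pow d (Suc 0) a b = gen (a, b)"
  by (simp add: if_distrib cong: if_cong)

lemma homog_gen_pow: "a < d \<Longrightarrow> b < d \<Longrightarrow> homog d h (gen_pow d h a b)"
proof (induction h arbitrary: a)
  case (Suc h)
  have "homog d (1 + h) (gen (a, c) * gen_pow d h c b)" if "c < d" for c
    using that Suc by (intro homog_mult homog_gen)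
  then show ?case by (auto intro!: homog_sum)
qed simp

definition gen_trace :: "nat \<Rightarrow> nat \<Rightarrow> exterior" where
  "gen_trace d h = (\<Sum>a<d. gen_pow d h a a)"

lemma homog_gen_trace: "homog d h (gen_trace d h)"
  unfolding gen_trace_def by (intro homog_sum homog_gen_pow) auto

lemma exterior_self_neg_eq_0: "x = - x \<Longrightarrow> x = (0 :: exterior)"
proof (rule exterior_eqI)
  fix S assume "x = - x"
  then have "coef x S = - coef x S" by (metis coef_simps(4))
  then show "coef x S = coef 0 S" by simp
qed

text \<open>Cyclicity of the trace with a sign: moving one entry past an entry of the odd power
  \<open>k\<close> = \<open>h\<close> - 1 costs -1, so the trace equals its own negative.\<close>

lemma gen_trace_even:
  assumes "even h" "0 < h"
  shows "gen_trace d h = 0"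
proof -
  define k where "k = h - 1"
  have h: "h = 1 + k" "h = k + 1" and k: "odd k" using assms by (auto simp: k_def)
  have "gen_trace d h = (\<Sum>a<d. \<Sum>c<d. gen_pow d 1 a c * gen_pow d k c a)"
    unfolding gen_trace_def h(1) by (intro sum.cong refl gen_pow_add) simp
  also have "\<dots> = (\<Sum>a<d. \<Sum>c<d. - (gen_pow d k c a * gen_pow d 1 a c))"
  proof (intro sum.cong refl)
    fix a c assume "a \<in> {..<d}" "c \<in> {..<d}"
    then have "homog d k (gen_pow d k c a)" "homog d 1 (gen_pow d 1 a c)"
      by (auto intro!: homog_gen_pow simp del: gen_pow.simps)
    from homog_commute[OF this] k
    show "gen_pow d 1 a c * gen_pow d k c a = - (gen_pow d k c a * gen_pow d 1 a c)" by simp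
  qed
  also have "\<dots> = - (\<Sum>c<d. \<Sum>a<d. gen_pow d k c a * gen_pow d 1 a c)"
    by (subst sum.swap) (simp add: sum_negf del: gen_pow.simps)
  also have "(\<Sum>c<d. \<Sum>a<d. gen_pow d k c a * gen_pow d 1 a c) = gen_trace d h"
    unfolding gen_trace_def h(2) by (intro sum.cong refl gen_pow_add[symmetric]) simp
  finally show ?thesis by (rule exterior_self_neg_eq_0)
qed

lemma homog_odd_square:
  assumes "homog d h f" "odd h"
  shows "f * f = 0"
  using homog_commute[OF assms(1,1)] assms(2) by (intro exterior_self_neg_eq_0) simp

text \<open>The Amitsur-Levitzki theorem for the generic matrix X. The entries of X^2 commute and
  its positive powers are traceless by \<open>gen_trace_even\<close>, so
  \<open>matrix_power_eq_0_of_traces\<close> with Y = X^2 makes its \<open>d\<close>-th power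
  vanish.\<close>

lemma gen_pow_double: "gen_pow d (2 * d) i j = 0" if ij: "i < d" "j < d"
proof -
  have even: "\<forall>S. coef (gen_pow d (2 * n) i j) S \<noteq> 0 \<longrightarrow> even (card S)" if "i < d" "j < d" for n i j
    using homog_gen_pow[OF that, of "2 * n"] by (auto simp: homog_def)
  define P where "P = (\<lambda>n i j. Abs_even_exterior (gen_pow d (2 * n) i j))"
  have of_P: "of_even (P n i j) = gen_pow d (2 * n) i j" if "i < d" "j < d" for n i j
    using even[OF that] by (simp add: P_def Abs_even_exterior_inverse)
  have of_sum: "of_even (sum f A) = (\<Sum>x\<in>A. of_even (f x))" for f and A :: "nat set"
    by (induction A rule: infinite_finite_induct) (simp_all add: zero_even_exterior.rep_eq plus_even_exterior.rep_eq)
  have of_nat: "of_even (of_nat n * x) = of_nat n * of_even x" for n x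
    by (induction n) (simp_all add: zero_even_exterior.rep_eq plus_even_exterior.rep_eq distrib_right)
  have "P d i j = 0"
  proof (rule matrix_power_eq_0_of_traces[of d P "P 1"])
    show "P 0 i j = (if i = j then 1 else 0)" for i j
      by (simp add: P_def zero_even_exterior_def one_even_exterior_def)
    show "P (Suc n) i j = (\<Sum>k<d. P n i k * P 1 k j)" if "i < d" "j < d" for n i j
      using gen_pow_add[OF that(1), of "2 * n" 2 j] that
      by (simp add: of_even_inject[symmetric] of_sum of_P times_even_exterior.rep_eq del: gen_pow.simps)
    show "(\<Sum>i<d. P (Suc n) i i) = 0" for n
      using gen_trace_even[of "2 * Suc n" d]
      by (simp add: of_even_inject[symmetric] of_sum of_P zero_even_exterior.rep_eq gen_trace_def del: gen_pow.simps)
    show "x = 0" if "0 < n" "of_nat n * x = 0" for n and x :: even_exterior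
    proof -
      from that(2) have "of_nat n * of_even x = 0" by (metis of_nat zero_even_exterior.rep_eq)
      then have "of_nat n * coef (of_even x) S = 0" for S by (metis coef_of_nat_mult coef_simps(1))
      then have "of_even x = 0" using that(1) by (intro exterior_eqI) simp
      then show ?thesis by (simp add: of_even_inject[symmetric] zero_even_exterior.rep_eq)
    qed
  qed (use ij in auto)
  then show ?thesis using of_P[OF ij, of d] by (simp add: zero_even_exterior.rep_eq)
qed

lemma gen_pow_eq_0:
  assumes "2 * d \<le> h" "a < d" "b < d"
  shows "gen_pow d h a b = 0"
proof -
  have "gen_pow d (2 * d + (h - 2 * d)) a b = 0"
    unfolding gen_pow_add[OF assms(2)] by (rule sum.neutral) (simp add: gen_pow_double assms del: gen_pow.simps)
  then show ?thesis using assms(1) by simp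
qed

lemma gen_trace_eq_0: "2 * d \<le> h \<Longrightarrow> gen_trace d h = 0"
  unfolding gen_trace_def by (rule sum.neutral) (simp add: gen_pow_eq_0)

section \<open>Invariant tensors\<close>

text \<open>On one tensor slot, the transposed matrix unit is the adjoint for the standard inner
  product: both sums run over the same pairs of index tuples that differ at most in slot
  \<open>k\<close>.\<close>

lemma sum_PiE_update_adjoint:
  fixes F G :: "('i \<Rightarrow> nat) \<Rightarrow> int"
  assumes "finite J" "k \<in> J" "i < d" "j < d"
  defines "I \<equiv> J \<rightarrow>\<^sub>E {..<d}"
  shows "(\<Sum>a\<in>I. (if a k = i then F (a(k := j)) else 0) * G a) =
    (\<Sum>a\<in>I. F a * (if a k = j then G (a(k := i)) else 0))"
proof -
  have fin: "finite I" using assms(1) by (simp add: I_def finite_PiE)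
  have "(\<Sum>a\<in>I. (if a k = i then F (a(k := j)) else 0) * G a) = (\<Sum>a\<in>{a \<in> I. a k = i}. F (a(k := j)) * G a)"
    using fin by (intro sum.mono_neutral_cong_right) auto
  also have "\<dots> = (\<Sum>a\<in>{a \<in> I. a k = j}. F a * G (a(k := i)))"
    by (rule sum.reindex_bij_witness[of _ "\<lambda>a. a(k := i)" "\<lambda>a. a(k := j)"])
      (use assms in \<open>auto simp: PiE_def Pi_def extensional_def\<close>)
  also have "\<dots> = (\<Sum>a\<in>I. F a * (if a k = j then G (a(k := i)) else 0))"
    using fin by (intro sum.mono_neutral_cong_left) auto
  finally show ?thesis .
qed

text \<open>A substitute for the first fundamental theorem of invariants of \<open>gl\<^sub>d\<close>. With
  \<open>L\<^sub>i\<^sub>j\<close> the action of the matrix unit on the upper indices, invariance turns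
  \<open>\<Sum>i j. \<langle>L\<^sub>i\<^sub>j \<phi>, L\<^sub>i\<^sub>j \<phi>\<rangle> = \<Sum>i j. \<langle>\<phi>, L\<^sub>j\<^sub>i L\<^sub>i\<^sub>j \<phi>\<rangle>\<close> into a sum of contractions.\<close>

lemma invariant_tensor_eq_0:
  fixes \<phi> :: "('i \<Rightarrow> nat) \<Rightarrow> ('i \<Rightarrow> nat) \<Rightarrow> int" and d :: nat
  assumes fin: "finite J" "J \<noteq> {}"
  defines "I \<equiv> J \<rightarrow>\<^sub>E {..<d}"
  assumes inv: "\<And>i j a b. i < d \<Longrightarrow> j < d \<Longrightarrow> a \<in> I \<Longrightarrow> b \<in> I \<Longrightarrow>
      (\<Sum>k\<in>J. if a k = i then \<phi> (a(k := j)) b else 0) = (\<Sum>k\<in>J. if b k = j then \<phi> a (b(k := i)) else 0)"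
    and contr: "\<And>k l a b. k \<in> J \<Longrightarrow> l \<in> J \<Longrightarrow> a \<in> I \<Longrightarrow> b \<in> I \<Longrightarrow> (\<Sum>c<d. \<phi> (a(k := c)) (b(l := c))) = 0"
    and ab: "a \<in> I" "b \<in> I"
  shows "\<phi> a b = 0"
proof -
  have finI: "finite I" using fin by (simp add: I_def finite_PiE)
  have upd: "a(k := c) \<in> I" if "a \<in> I" "k \<in> J" "c < d" for a k c
    using that by (auto simp: I_def PiE_def extensional_def Pi_def)
  define L where "L = (\<lambda>i j a b. \<Sum>k\<in>J. if a k = i then \<phi> (a(k := j)) b else 0)"
  \<comment> \<open>Invariance moves the inner operator to the lower indices. Then slots
    \<open>k\<close> and \<open>l\<close> carry the same summation index \<open>i\<close>, so
    summing over \<open>i\<close> is a contraction, which vanishes by \<open>contr\<close>.\<close>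
  have LL: "(\<Sum>i<d. \<Sum>j<d. \<Sum>k\<in>J. if a k = j then L i j (a(k := i)) b else 0) = 0" if "a \<in> I" "b \<in> I" for a b
  proof -
    have "(\<Sum>i<d. \<Sum>j<d. \<Sum>k\<in>J. if a k = j then L i j (a(k := i)) b else 0) =
        (\<Sum>i<d. \<Sum>j<d. \<Sum>k\<in>J. \<Sum>l\<in>J. if a k = j \<and> b l = j then \<phi> (a(k := i)) (b(l := i)) else 0)"
    proof (intro sum.cong[OF refl])
      fix i j k assume "i \<in> {..<d}" "j \<in> {..<d}" "k \<in> J"
      then show "(if a k = j then L i j (a(k := i)) b else 0) =
          (\<Sum>l\<in>J. if a k = j \<and> b l = j then \<phi> (a(k := i)) (b(l := i)) else 0)"
        using inv[of i j "a(k := i)" b] that upd by (simp add: L_def)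
    qed
    also have "\<dots> = (\<Sum>j<d. \<Sum>k\<in>J. \<Sum>l\<in>J. \<Sum>i<d. if a k = j \<and> b l = j then \<phi> (a(k := i)) (b(l := i)) else 0)"
      by (subst sum.swap, rule sum.cong[OF refl], subst sum.swap, rule sum.cong[OF refl], rule sum.swap)
    also have "\<dots> = (\<Sum>j<d. \<Sum>k\<in>J. \<Sum>l\<in>J. if a k = j \<and> b l = j then \<Sum>i<d. \<phi> (a(k := i)) (b(l := i)) else 0)"
      by (intro sum.cong[OF refl]) (auto intro!: sum.neutral)
    also have "\<dots> = 0" using contr that by (intro sum.neutral ballI) simp
    finally show ?thesis .
  qed
  have adj: "(\<Sum>a\<in>I. L i j a b * L i j a b) = (\<Sum>a\<in>I. \<phi> a b * (\<Sum>k\<in>J. if a k = j then L i j (a(k := i)) b else 0))"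
    if "i < d" "j < d" for i j b
  proof -
    have "(\<Sum>a\<in>I. L i j a b * L i j a b) = (\<Sum>a\<in>I. \<Sum>k\<in>J. (if a k = i then \<phi> (a(k := j)) b else 0) * L i j a b)"
      by (subst (1) L_def) (simp add: sum_distrib_right)
    also have "\<dots> = (\<Sum>k\<in>J. \<Sum>a\<in>I. (if a k = i then \<phi> (a(k := j)) b else 0) * L i j a b)"
      by (rule sum.swap)
    also have "\<dots> = (\<Sum>k\<in>J. \<Sum>a\<in>I. \<phi> a b * (if a k = j then L i j (a(k := i)) b else 0))"
      unfolding I_def using that fin by (intro sum.cong[OF refl] sum_PiE_update_adjoint)
    also have "\<dots> = (\<Sum>a\<in>I. \<Sum>k\<in>J. \<phi> a b * (if a k = j then L i j (a(k := i)) b else 0))"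
      by (rule sum.swap)
    finally show ?thesis by (simp add: sum_distrib_left)
  qed
  have "(\<Sum>i<d. \<Sum>j<d. \<Sum>b\<in>I. \<Sum>a\<in>I. L i j a b * L i j a b) =
      (\<Sum>i<d. \<Sum>j<d. \<Sum>b\<in>I. \<Sum>a\<in>I. \<phi> a b * (\<Sum>k\<in>J. if a k = j then L i j (a(k := i)) b else 0))"
    by (intro sum.cong[OF refl] adj) auto
  also have "\<dots> = (\<Sum>b\<in>I. \<Sum>a\<in>I. \<Sum>i<d. \<Sum>j<d. \<phi> a b * (\<Sum>k\<in>J. if a k = j then L i j (a(k := i)) b else 0))"
  proof -
    have "(\<Sum>i<d. \<Sum>j<d. \<Sum>b\<in>I. \<Sum>a\<in>I. f i j a b) = (\<Sum>b\<in>I. \<Sum>a\<in>I. \<Sum>i<d. \<Sum>j<d. f i j a b)" for f :: "nat \<Rightarrow> nat \<Rightarrow> _ \<Rightarrow> _ \<Rightarrow> int"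
    proof -
      have "(\<Sum>i<d. \<Sum>j<d. \<Sum>b\<in>I. \<Sum>a\<in>I. f i j a b) = (\<Sum>i<d. \<Sum>b\<in>I. \<Sum>j<d. \<Sum>a\<in>I. f i j a b)"
        by (rule sum.cong[OF refl], rule sum.swap)
      also have "\<dots> = (\<Sum>b\<in>I. \<Sum>i<d. \<Sum>j<d. \<Sum>a\<in>I. f i j a b)" by (rule sum.swap)
      also have "\<dots> = (\<Sum>b\<in>I. \<Sum>i<d. \<Sum>a\<in>I. \<Sum>j<d. f i j a b)"
        by (rule sum.cong[OF refl], rule sum.cong[OF refl], rule sum.swap)
      also have "\<dots> = (\<Sum>b\<in>I. \<Sum>a\<in>I. \<Sum>i<d. \<Sum>j<d. f i j a b)"
        by (rule sum.cong[OF refl], rule sum.swap)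
      finally show ?thesis .
    qed
    then show ?thesis .
  qed
  also have "\<dots> = (\<Sum>b\<in>I. \<Sum>a\<in>I. \<phi> a b * (\<Sum>i<d. \<Sum>j<d. \<Sum>k\<in>J. if a k = j then L i j (a(k := i)) b else 0))"
    by (simp only: sum_distrib_left)
  also have "\<dots> = 0" using LL by (intro sum.neutral ballI) simp
  finally have sq: "(\<Sum>i<d. \<Sum>j<d. \<Sum>b\<in>I. \<Sum>a\<in>I. L i j a b * L i j a b) = 0" .
  \<comment> \<open>A vanishing sum of integer squares has only vanishing terms.\<close>
  have L0: "L i i a b = 0" if "i < d" for i
  proof -
    have 1: "(\<Sum>j<d. \<Sum>b\<in>I. \<Sum>a\<in>I. L i j a b * L i j a b) = 0"
      using sq that by (subst (asm) sum_nonneg_eq_0_iff) (auto intro!: sum_nonneg)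
    have 2: "(\<Sum>b\<in>I. \<Sum>a\<in>I. L i i a b * L i i a b) = 0"
      using 1 that by (subst (asm) sum_nonneg_eq_0_iff) (auto intro!: sum_nonneg)
    have "(\<Sum>a\<in>I. L i i a b * L i i a b) = 0"
      using 2 ab finI by (subst (asm) sum_nonneg_eq_0_iff) (auto intro!: sum_nonneg)
    then show ?thesis
      using ab finI by (subst (asm) sum_nonneg_eq_0_iff) auto
  qed
  \<comment> \<open>The identity matrix acts on a tensor as multiplication by the number of slots,
    which is positive.\<close>
  have "0 = (\<Sum>i<d. L i i a b)" using L0 by simp
  also have "\<dots> = (\<Sum>k\<in>J. \<Sum>i<d. if a k = i then \<phi> (a(k := i)) b else 0)"
    unfolding L_def by (rule sum.swap)
  also have "\<dots> = (\<Sum>k\<in>J. \<phi> a b)"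
    using ab by (intro sum.cong[OF refl]) (auto simp: I_def PiE_def Pi_def)
  finally show ?thesis using fin by simp
qed

section \<open>The adjoint action and products of entries of powers\<close>

text \<open>The derivation of the exterior algebra induced by \<open>X \<mapsto> E\<^sub>i\<^sub>j X - X E\<^sub>i\<^sub>j\<close>.\<close>

definition ad_deriv :: "nat \<Rightarrow> nat \<Rightarrow> nat \<Rightarrow> exterior \<Rightarrow> exterior" where
  "ad_deriv d i j f = (\<Sum>b<d. replace_gen (i, b) (j, b) f) - (\<Sum>a<d. replace_gen (a, j) (a, i) f)"

lemma ad_deriv_mult: "ad_deriv d i j (f * g) = ad_deriv d i j f * g + f * ad_deriv d i j g"
  by (simp add: ad_deriv_def replace_gen_mult sum.distrib sum_distrib_left sum_distrib_right algebra_simps)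

lemma ad_deriv_simps [simp]:
  "ad_deriv d i j 0 = 0" "ad_deriv d i j 1 = 0"
  "ad_deriv d i j (f + g) = ad_deriv d i j f + ad_deriv d i j g"
  by (simp_all add: ad_deriv_def sum.distrib)

lemma ad_deriv_sum: "ad_deriv d i j (sum f A) = (\<Sum>x\<in>A. ad_deriv d i j (f x))"
  by (induction A rule: infinite_finite_induct) simp_all

lemma ad_deriv_gen:
  assumes "a < d" "b < d"
  shows "ad_deriv d i j (gen (a, b)) =
    (if a = i then gen (j, b) else 0) - (if b = j then gen (a, i) else 0)"
proof -
  have "(\<Sum>c<d. replace_gen (i, c) (j, c) (gen (a, b))) = (\<Sum>c<d. if c = b then (if a = i then gen (j, b) else 0) else 0)"
    by (rule sum.cong) auto
  moreover have "(\<Sum>c<d. replace_gen (c, j) (c, i) (gen (a, b))) = (\<Sum>c<d. if c = a then (if b = j then gen (a, i) else 0) else 0)"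
    by (rule sum.cong) auto
  ultimately show ?thesis using assms by (simp add: ad_deriv_def)
qed

text \<open>On the top monomial a linear substitution acts by its trace. The replacements contribute
  only for \<open>i\<close> = \<open>j\<close>, where the two sums give \<open>d\<close> copies each
  and cancel.\<close>

lemma ad_deriv_top:
  assumes "i < d" "j < d"
  shows "coef (ad_deriv d i j f) ({..<d} \<times> {..<d}) = 0"
  using assms by (simp add: ad_deriv_def coef_sum coef_replace_gen)

text \<open>Powers transform like X itself: in the product rule the two terms at the inner index, at
  \<open>c\<close> = \<open>j\<close> and at \<open>c\<close> = \<open>i\<close>, cancel.\<close>

lemma ad_deriv_gen_pow:
  assumes "a < d" "b < d" "i < d" "j < d"
  shows "ad_deriv d i j (gen_pow d h a b) =
    (if a = i then gen_pow d h j b else 0) - (if b = j then gen_pow d h a i else 0)"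
  using assms
proof (induction h arbitrary: a)
  case 0
  then show ?case by auto
next
  case (Suc h)
  have "ad_deriv d i j (gen_pow d (Suc h) a b) = (\<Sum>c<d.
      (if a = i then gen (j, c) * gen_pow d h c b else 0) - (if c = j then gen (a, i) * gen_pow d h c b else 0)
      + (if c = i then gen (a, c) * gen_pow d h j b else 0) - (if b = j then gen (a, c) * gen_pow d h c i else 0))"
    unfolding gen_pow.simps ad_deriv_sum
  proof (rule sum.cong[OF refl])
    fix c assume "c \<in> {..<d}"
    with Suc.prems Suc.IH[of c] show "ad_deriv d i j (gen (a, c) * gen_pow d h c b) =
      (if a = i then gen (j, c) * gen_pow d h c b else 0) - (if c = j then gen (a, i) * gen_pow d h c b else 0)
      + (if c = i then gen (a, c) * gen_pow d h j b else 0) - (if b = j then gen (a, c) * gen_pow d h c i else 0)"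
      by (simp add: ad_deriv_mult ad_deriv_gen left_diff_distrib right_diff_distrib)
  qed
  also have "\<dots> = (if a = i then gen_pow d (Suc h) j b else 0) - (if b = j then gen_pow d (Suc h) a i else 0)"
    using Suc.prems by (simp add: sum.distrib sum_subtractf)
  finally show ?case .
qed

lemma ad_deriv_gen_trace:
  assumes "i < d" "j < d"
  shows "ad_deriv d i j (gen_trace d h) = 0"
proof -
  have "ad_deriv d i j (gen_trace d h) = (\<Sum>a<d. (if a = i then gen_pow d h j a else 0) - (if a = j then gen_pow d h a i else 0))"
    unfolding gen_trace_def ad_deriv_sum using assms by (intro sum.cong) (auto simp: ad_deriv_gen_pow)
  also have "\<dots> = 0" using assms by (simp add: sum_subtractf)
  finally show ?thesis .
qed

text \<open>Factors carry labels \<open>j\<close>, with exponents and indices as functions of the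
  label and \<open>js\<close> fixing the order. Contracting and merging factors thus become function
  updates.\<close>

definition tprod :: "nat \<Rightarrow> ('i \<Rightarrow> nat) \<Rightarrow> 'i list \<Rightarrow> ('i \<Rightarrow> nat) \<Rightarrow> ('i \<Rightarrow> nat) \<Rightarrow> exterior" where
  "tprod d h js a b = prod_list (map (\<lambda>j. gen_pow d (h j) (a j) (b j)) js)"

lemma tprod_Nil [simp]: "tprod d h [] a b = 1"
  and tprod_Cons: "tprod d h (j # js) a b = gen_pow d (h j) (a j) (b j) * tprod d h js a b"
  and tprod_append: "tprod d h (js @ ks) a b = tprod d h js a b * tprod d h ks a b"
  by (simp_all add: tprod_def)

lemma tprod_cong:
  "(\<And>j. j \<in> set js \<Longrightarrow> h j = h' j \<and> a j = a' j \<and> b j = b' j) \<Longrightarrow> tprod d h js a b = tprod d h' js a' b'"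
  unfolding tprod_def by (rule arg_cong[of _ _ prod_list], rule map_cong) auto

lemma homog_tprod:
  "(\<And>j. j \<in> set js \<Longrightarrow> a j < d \<and> b j < d) \<Longrightarrow> homog d (sum_list (map h js)) (tprod d h js a b)"
  by (induction js) (auto simp: tprod_Cons intro!: homog_mult homog_gen_pow)

lemma ad_deriv_tprod:
  assumes "distinct js" "\<And>k. k \<in> set js \<Longrightarrow> a k < d \<and> b k < d" "i < d" "j < d"
  shows "ad_deriv d i j (tprod d h js a b) =
    (\<Sum>k\<in>set js. (if a k = i then tprod d h js (a(k := j)) b else 0) - (if b k = j then tprod d h js a (b(k := i)) else 0))"
  using assms(1,2)
proof (induction js)
  case (Cons l js)
  let ?P = "gen_pow d (h l)"
  have "(\<Sum>k\<in>set js. (if a k = i then tprod d h (l # js) (a(k := j)) b else 0) - (if b k = j then tprod d h (l # js) a (b(k := i)) else 0))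
    = ?P (a l) (b l) * ad_deriv d i j (tprod d h js a b)"
    using Cons by (simp add: sum_distrib_left) (rule sum.cong[OF refl], auto simp: tprod_Cons algebra_simps)
  moreover have "(if a l = i then tprod d h (l # js) (a(l := j)) b else 0) - (if b l = j then tprod d h (l # js) a (b(l := i)) else 0)
    = ad_deriv d i j (?P (a l) (b l)) * tprod d h js a b"
  proof -
    have "tprod d h js (a(l := j)) b = tprod d h js a b" "tprod d h js a (b(l := i)) = tprod d h js a b"
      using Cons.prems by (auto intro!: tprod_cong)
    then show ?thesis using Cons.prems assms(3,4) by (simp add: ad_deriv_gen_pow tprod_Cons left_diff_distrib)
  qed
  ultimately show ?case using Cons.prems by (simp add: tprod_Cons ad_deriv_mult)
qed simp

lemma minus_one_power_left_commute: "x * ((- 1) ^ n * y) = (- 1) ^ n * (x * (y :: 'a::ring_1))"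
  by (induction n) simp_all

text \<open>The sign does not depend on the indices, so it can be pulled out of contractions.\<close>

lemma tprod_move_to_front:
  assumes "k \<in> set js"
  obtains n where "\<And>a b. (\<And>j. j \<in> set js \<Longrightarrow> a j < d \<and> b j < d) \<Longrightarrow>
    tprod d h js a b = (- 1) ^ n * (gen_pow d (h k) (a k) (b k) * tprod d h (remove1 k js) a b)"
proof -
  obtain xs ys where js: "js = xs @ k # ys" "k \<notin> set xs" using assms by (metis split_list_first)
  have rem: "remove1 k js = xs @ ys" using js by (simp add: remove1_append)
  have "tprod d h js a b = (- 1) ^ (h k * sum_list (map h xs)) * (gen_pow d (h k) (a k) (b k) * tprod d h (remove1 k js) a b)"
    if ab: "\<And>j. j \<in> set js \<Longrightarrow> a j < d \<and> b j < d" for a b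
  proof -
    have "homog d (sum_list (map h xs)) (tprod d h xs a b)" "homog d (h k) (gen_pow d (h k) (a k) (b k))"
      using ab js by (auto intro!: homog_tprod homog_gen_pow)
    from homog_commute[OF this(2,1)]
    have "tprod d h xs a b * gen_pow d (h k) (a k) (b k) =
      (- 1) ^ (h k * sum_list (map h xs)) * (gen_pow d (h k) (a k) (b k) * tprod d h xs a b)" .
    then show ?thesis
      unfolding rem unfolding js(1) tprod_append tprod_Cons by (metis mult.assoc)
  qed
  then show thesis by (rule that)
qed

section \<open>Reduction to products of traces\<close>

lemma minus_one_power_eq_0_iff: "(- 1) ^ n * x = 0 \<longleftrightarrow> x = (0 :: 'a::ring_1)"
  by (cases "even n") simp_all

definition trace_prod :: "nat \<Rightarrow> nat list \<Rightarrow> exterior" where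
  "trace_prod d ss = prod_list (map (gen_trace d) ss)"

lemma homog_trace_prod: "homog d (sum_list ss) (trace_prod d ss)"
  by (induction ss) (auto simp: trace_prod_def intro!: homog_mult homog_gen_trace)

lemma ad_deriv_trace_prod: "i < d \<Longrightarrow> j < d \<Longrightarrow> ad_deriv d i j (trace_prod d ss) = 0"
  by (induction ss) (simp_all add: trace_prod_def ad_deriv_mult ad_deriv_gen_trace)

text \<open>Contracting a factor with itself turns it into a trace; this trace is moved past the
  other factors at the cost of a sign.\<close>

lemma contract_same:
  assumes js: "distinct js" "k \<in> set js"
    and ab: "\<And>j. j \<in> set js \<Longrightarrow> a j < d \<and> b j < d"
    and nz: "(\<Sum>c<d. tprod d h js (a(k := c)) (b(k := c)) * trace_prod d ss) \<noteq> 0"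
  shows "tprod d h (remove1 k js) a b * trace_prod d (h k # ss) \<noteq> 0"
proof -
  define rest where "rest = tprod d h (remove1 k js) a b"
  obtain n where n: "\<And>a b. (\<And>j. j \<in> set js \<Longrightarrow> a j < d \<and> b j < d) \<Longrightarrow>
      tprod d h js a b = (- 1) ^ n * (gen_pow d (h k) (a k) (b k) * tprod d h (remove1 k js) a b)"
    using tprod_move_to_front[OF js(2)] by blast
  have "tprod d h js (a(k := c)) (b(k := c)) = (- 1) ^ n * (gen_pow d (h k) c c * rest)" if "c < d" for c
  proof -
    have "tprod d h (remove1 k js) (a(k := c)) (b(k := c)) = rest"
      unfolding rest_def by (rule tprod_cong) (use js in auto)
    then show ?thesis using n[of "a(k := c)" "b(k := c)"] ab that by simp
  qed
  then have "(\<Sum>c<d. tprod d h js (a(k := c)) (b(k := c)) * trace_prod d ss) =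
      (- 1) ^ n * (gen_trace d (h k) * rest * trace_prod d ss)"
    by (simp add: gen_trace_def sum_distrib_left sum_distrib_right mult.assoc)
  then have "gen_trace d (h k) * rest * trace_prod d ss \<noteq> 0" using nz by auto
  moreover have "homog d (sum_list (map h (remove1 k js))) rest"
    unfolding rest_def using ab set_remove1_subset[of k js] by (intro homog_tprod) blast
  then have "gen_trace d (h k) * rest * u = (- 1) ^ (sum_list (map h (remove1 k js)) * h k) * (rest * (gen_trace d (h k) * u))" for u
    by (simp only: homog_commute[OF _ homog_gen_trace] mult.assoc)
  ultimately show ?thesis
    by (auto simp: trace_prod_def rest_def)
qed

text \<open>Summing over the common index multiplies factor \<open>l\<close> by factor
  \<open>k\<close> as matrices. The product keeps the label \<open>l\<close> and takes over the
  lower index of \<open>k\<close>.\<close>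

lemma contract_distinct:
  assumes js: "distinct js" "k \<in> set js" "l \<in> set js" "k \<noteq> l"
    and ab: "\<And>j. j \<in> set js \<Longrightarrow> a j < d \<and> b j < d"
    and nz: "(\<Sum>c<d. tprod d h js (a(k := c)) (b(l := c)) * Q) \<noteq> 0"
  shows "tprod d (h(l := h l + h k)) (l # remove1 k (remove1 l js)) a (b(l := b k)) * Q \<noteq> 0"
proof -
  let ?ks = "remove1 l js" let ?rs = "remove1 k ?ks"
  define rest where "rest = tprod d h ?rs a b"
  obtain n where n: "\<And>a b. (\<And>j. j \<in> set js \<Longrightarrow> a j < d \<and> b j < d) \<Longrightarrow>
      tprod d h js a b = (- 1) ^ n * (gen_pow d (h l) (a l) (b l) * tprod d h ?ks a b)"
    using tprod_move_to_front[OF js(3)] by blast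
  have k: "k \<in> set ?ks" using js by simp
  obtain n' where n': "\<And>a b. (\<And>j. j \<in> set ?ks \<Longrightarrow> a j < d \<and> b j < d) \<Longrightarrow>
      tprod d h ?ks a b = (- 1) ^ n' * (gen_pow d (h k) (a k) (b k) * tprod d h ?rs a b)"
    using tprod_move_to_front[OF k] by blast
  have rest: "tprod d h ?rs (a(k := c)) (b(l := c)) = rest" for c
    unfolding rest_def by (rule tprod_cong) (use js in auto)
  have "tprod d h js (a(k := c)) (b(l := c)) =
      (- 1) ^ n * ((- 1) ^ n' * (gen_pow d (h l) (a l) c * gen_pow d (h k) c (b k) * rest))" if "c < d" for c
  proof -
    have idx: "(a(k := c)) j < d \<and> (b(l := c)) j < d" if "j \<in> set js" for j
      using ab[OF that] \<open>c < d\<close> by auto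
    have "tprod d h ?ks (a(k := c)) (b(l := c)) = (- 1) ^ n' * (gen_pow d (h k) c (b k) * rest)"
      using n'[of "a(k := c)" "b(l := c)", OF idx[OF set_remove1_subset[THEN subsetD]]] js(4) by (simp add: rest)
    moreover have "tprod d h js (a(k := c)) (b(l := c)) =
        (- 1) ^ n * (gen_pow d (h l) (a l) c * tprod d h ?ks (a(k := c)) (b(l := c)))"
      using n[of "a(k := c)" "b(l := c)", OF idx] js(4) by simp
    ultimately show ?thesis
      by (simp add: mult.assoc minus_one_power_left_commute[of "gen_pow d (h l) (a l) c"])
  qed
  then have "(\<Sum>c<d. tprod d h js (a(k := c)) (b(l := c)) * Q) =
      (- 1) ^ n * ((- 1) ^ n' * (gen_pow d (h l + h k) (a l) (b k) * rest * Q))"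
    using ab js by (simp add: gen_pow_add sum_distrib_left sum_distrib_right mult.assoc)
  moreover have "tprod d (h(l := h l + h k)) ?rs a (b(l := b k)) = rest"
    unfolding rest_def by (rule tprod_cong) (use js in auto)
  ultimately show ?thesis using nz by (auto simp: tprod_Cons)
qed

text \<open>The top coefficient, as a tensor \<open>\<phi>\<close> in the upper and lower indices,
  is invariant: \<open>ad_deriv\<close> has zero top coefficient and kills the traces, so its
  product rule is exactly the invariance condition. If all contractions vanished,
  \<open>invariant_tensor_eq_0\<close> would give \<open>\<phi>\<close> = 0.\<close>

lemma exists_nonzero_contraction:
  assumes js: "distinct js" "js \<noteq> []"
    and ab: "\<And>j. j \<in> set js \<Longrightarrow> a j < d \<and> b j < d"
    and deg: "sum_list (map h js) + sum_list ss = d\<^sup>2"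
    and nz: "tprod d h js a b * trace_prod d ss \<noteq> 0"
  obtains k l a' b' where "k \<in> set js" "l \<in> set js" "\<And>j. j \<in> set js \<Longrightarrow> a' j < d \<and> b' j < d"
    "(\<Sum>c<d. tprod d h js (a'(k := c)) (b'(l := c)) * trace_prod d ss) \<noteq> 0"
proof (rule ccontr)
  note obt = that
  let ?Q = "trace_prod d ss"
  let ?I = "set js \<rightarrow>\<^sub>E {..<d}"
  define \<phi> where "\<phi> = (\<lambda>a b. coef (tprod d h js a b * ?Q) ({..<d} \<times> {..<d}))"
  assume "\<not> thesis"
  then have zero: "(\<Sum>c<d. tprod d h js (a'(k := c)) (b'(l := c)) * ?Q) = 0"
    if "k \<in> set js" "l \<in> set js" "\<And>j. j \<in> set js \<Longrightarrow> a' j < d \<and> b' j < d" for k l a' b'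
    using obt[of k l a' b'] \<open>\<not> thesis\<close> that by blast
  have restr: "a \<in> ?I \<Longrightarrow> b \<in> ?I \<Longrightarrow> j \<in> set js \<Longrightarrow> a j < d \<and> b j < d" for a b :: "_ \<Rightarrow> nat" and j
    by (auto simp: PiE_def Pi_def)
  \<comment> \<open>Index functions are restricted because the invariant tensor lives on extensional
    functions.\<close>
  have "\<phi> (restrict a (set js)) (restrict b (set js)) = 0"
  proof (rule invariant_tensor_eq_0[where J = "set js"])
    fix i j a b assume ij: "i < d" "j < d" and I: "a \<in> ?I" "b \<in> ?I"
    have "0 = coef (ad_deriv d i j (tprod d h js a b * ?Q)) ({..<d} \<times> {..<d})"
      using ij by (simp add: ad_deriv_top)
    also have "\<dots> = (\<Sum>k\<in>set js. (if a k = i then \<phi> (a(k := j)) b else 0) - (if b k = j then \<phi> a (b(k := i)) else 0))"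
      using js ij restr[OF I]
      by (simp add: ad_deriv_mult ad_deriv_trace_prod ad_deriv_tprod sum_distrib_right coef_sum \<phi>_def)
        (rule sum.cong[OF refl], auto simp: left_diff_distrib \<phi>_def)
    finally show "(\<Sum>k\<in>set js. if a k = i then \<phi> (a(k := j)) b else 0) =
        (\<Sum>k\<in>set js. if b k = j then \<phi> a (b(k := i)) else 0)"
      by (simp add: sum_subtractf)
  next
    fix k l a b assume "k \<in> set js" "l \<in> set js" "a \<in> ?I" "b \<in> ?I"
    then show "(\<Sum>c<d. \<phi> (a(k := c)) (b(l := c))) = 0"
      using zero[of k l a b] restr[of a b] by (simp add: \<phi>_def coef_sum[symmetric])
  qed (use js ab in auto)
  moreover have "tprod d h js (restrict a (set js)) (restrict b (set js)) = tprod d h js a b"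
    by (rule tprod_cong) simp
  ultimately have "coef (tprod d h js a b * ?Q) ({..<d} \<times> {..<d}) = 0" by (simp add: \<phi>_def)
  moreover have "homog d (d\<^sup>2) (tprod d h js a b * ?Q)"
    using homog_mult[OF homog_tprod homog_trace_prod, of js a d b h ss] ab deg by auto
  ultimately show False using nz homog_top_eq_0_iff by blast
qed

text \<open>Contracting repeatedly merges the factors into traces. The weights \<open>w\<close> record how the
  factors are distributed over the resulting traces.\<close>

lemma tprod_reduce_to_traces:
  fixes ts :: "(nat \<times> nat) list"
  assumes "distinct js"
    and "\<And>j. j \<in> set js \<Longrightarrow> a j < d \<and> b j < d"
    and "sum_list (map h js) + sum_list (map fst ts) = d\<^sup>2"
    and "tprod d h js a b * trace_prod d (map fst ts) \<noteq> 0"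
    and "\<And>j. j \<in> set js \<Longrightarrow> 0 < h j \<and> w j * c \<le> h j"
    and "\<And>s v. (s, v) \<in> set ts \<Longrightarrow> 0 < s \<and> v * c \<le> s"
  shows "\<exists>ts'. trace_prod d (map fst ts') \<noteq> 0 \<and> sum_list (map fst ts') = d\<^sup>2 \<and>
    sum_list (map snd ts') = sum_list (map w js) + sum_list (map snd ts) \<and>
    (\<forall>(s, v)\<in>set ts'. 0 < s \<and> v * c \<le> s)"
  using assms
proof (induction "length js" arbitrary: js a b h w ts)
  case 0
  then show ?case by (intro exI[of _ ts]) auto
next
  case (Suc n)
  note prems = Suc.prems
  have "js \<noteq> []" using Suc.hyps by auto
  obtain k l a' b' where kl: "k \<in> set js" "l \<in> set js" and ab': "\<And>j. j \<in> set js \<Longrightarrow> a' j < d \<and> b' j < d"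
    and nz: "(\<Sum>c<d. tprod d h js (a'(k := c)) (b'(l := c)) * trace_prod d (map fst ts)) \<noteq> 0"
    using exists_nonzero_contraction[OF prems(1) \<open>js \<noteq> []\<close> prems(2,3,4)] by blast
  have sum_remove: "sum_list (map f js) = f k + sum_list (map f (remove1 k js))" if "k \<in> set js" for f :: "_ \<Rightarrow> nat" and k js
    using that by (simp add: sum_list_map_remove1)
  show ?case
  proof (cases "k = l")
    case True
    have nz': "tprod d h (remove1 k js) a' b' * trace_prod d (map fst ((h k, w k) # ts)) \<noteq> 0"
      using contract_same[OF prems(1) kl(1) ab'] nz True by simp
    have len: "n = length (remove1 k js)" using Suc.hyps(2) kl by (simp add: length_remove1)
    have "\<exists>ts'. trace_prod d (map fst ts') \<noteq> 0 \<and> sum_list (map fst ts') = d\<^sup>2 \<and>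
      sum_list (map snd ts') = sum_list (map w (remove1 k js)) + sum_list (map snd ((h k, w k) # ts)) \<and>
      (\<forall>(s, v)\<in>set ts'. 0 < s \<and> v * c \<le> s)"
    proof (rule Suc.hyps(1)[OF len _ _ _ nz'])
      show "sum_list (map h (remove1 k js)) + sum_list (map fst ((h k, w k) # ts)) = d\<^sup>2"
        using prems(3) sum_remove[OF kl(1), of h] by simp
      have sub: "set (remove1 k js) \<subseteq> set js" by (rule set_remove1_subset)
      show "distinct (remove1 k js)" using prems(1) by (rule distinct_remove1)
      show "a' j < d \<and> b' j < d" "0 < h j \<and> w j * c \<le> h j" if "j \<in> set (remove1 k js)" for j
        using ab'[of j] prems(5)[of j] sub that by blast+
      show "0 < s \<and> v * c \<le> s" if "(s, v) \<in> set ((h k, w k) # ts)" for s v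
        using that prems(5)[OF kl(1)] prems(6)[of s v] by auto
    qed
    then show ?thesis using sum_remove[OF kl(1), of w] by (simp add: add_ac)
  next
    case False
    let ?rs = "remove1 k (remove1 l js)"
    \<comment> \<open>Exponents and weights are added together, so the linear bound of weight by
      exponent survives the merging.\<close>
    let ?h = "h(l := h l + h k)" and ?w = "w(l := w l + w k)"
    have nz': "tprod d ?h (l # ?rs) a' (b'(l := b' k)) * trace_prod d (map fst ts) \<noteq> 0"
      by (rule contract_distinct[OF prems(1) kl False ab' nz])
    have k: "k \<in> set (remove1 l js)" using kl False by simp
    have len: "n = length (l # ?rs)" using Suc.hyps(2) kl k length_pos_if_in_set[OF k] by (simp add: length_remove1)
    have l: "l \<notin> set ?rs" and rs: "set ?rs \<subseteq> set js" using prems(1) by auto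
    have upd: "sum_list (map (f(l := f l + f k)) (l # ?rs)) = sum_list (map f js)" for f :: "_ \<Rightarrow> nat"
    proof -
      have "map (f(l := f l + f k)) ?rs = map f ?rs" using l by (intro map_cong) auto
      then have "sum_list (map (f(l := f l + f k)) (l # ?rs)) = f l + f k + sum_list (map f ?rs)"
        by (simp only: list.map sum_list.Cons fun_upd_same)
      then show ?thesis using sum_remove[OF kl(2), of f] sum_remove[OF k, of f] by simp
    qed
    have "\<exists>ts'. trace_prod d (map fst ts') \<noteq> 0 \<and> sum_list (map fst ts') = d\<^sup>2 \<and>
      sum_list (map snd ts') = sum_list (map ?w (l # ?rs)) + sum_list (map snd ts) \<and>
      (\<forall>(s, v)\<in>set ts'. 0 < s \<and> v * c \<le> s)"
    proof (rule Suc.hyps(1)[OF len _ _ _ nz'])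
      show "sum_list (map ?h (l # ?rs)) + sum_list (map fst ts) = d\<^sup>2"
        using prems(3) upd[of h] by simp
      show "0 < ?h j \<and> ?w j * c \<le> ?h j" if "j \<in> set (l # ?rs)" for j
        using prems(5)[of j] prems(5)[OF kl(1)] prems(5)[OF kl(2)] rs that by (auto simp: add_mult_distrib)
      show "a' j < d \<and> (b'(l := b' k)) j < d" if "j \<in> set (l # ?rs)" for j
        using that rs kl(2) ab'[of j] ab'[OF kl(1)] by auto
      show "distinct (l # ?rs)" using prems(1) l by simp
    qed (fact prems(6))
    then show ?thesis using upd[of w] by simp
  qed
qed

text \<open>A repeated trace can be moved next to its twin up to sign, and an element of odd degree
  squares to zero.\<close>

lemma trace_prod_repeat_eq_0:
  assumes "\<not> distinct ss" "\<forall>s\<in>set ss. odd s"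
  shows "trace_prod d ss = 0"
proof -
  obtain xs ys zs s where ss: "ss = xs @ [s] @ ys @ [s] @ zs" using not_distinct_decomp[OF assms(1)] by blast
  have app: "trace_prod d (us @ vs) = trace_prod d us * trace_prod d vs" for us vs
    by (simp add: trace_prod_def)
  have s: "trace_prod d [s] = gen_trace d s" by (simp add: trace_prod_def)
  have "trace_prod d ys * gen_trace d s = (- 1) ^ (s * sum_list ys) * (gen_trace d s * trace_prod d ys)"
    by (rule homog_commute[OF homog_gen_trace homog_trace_prod])
  then have "gen_trace d s * (trace_prod d ys * gen_trace d s) =
      (- 1) ^ (s * sum_list ys) * (gen_trace d s * gen_trace d s * trace_prod d ys)"
    by (simp add: minus_one_power_left_commute mult.assoc)
  also have "gen_trace d s * gen_trace d s = 0"
    using assms(2) ss by (intro homog_odd_square[OF homog_gen_trace]) auto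
  finally have "gen_trace d s * (trace_prod d ys * gen_trace d s) = 0" by simp
  then have "gen_trace d s * (trace_prod d ys * (gen_trace d s * u)) = 0" for u
    by (metis mult.assoc mult_zero_left)
  then show ?thesis unfolding ss app s by simp
qed

lemma sum_odd: "(\<Sum>i<d. 2 * i + 1) = d\<^sup>2" for d :: nat
  by (induction d) (simp_all add: power2_eq_square)

text \<open>The exponents must be distinct odd numbers below \<open>2 * d\<close>. All such numbers
  together already sum to exactly \<open>d\<^sup>2\<close>, so none of them can be missing.\<close>

lemma trace_prod_top_nonzero:
  assumes nz: "trace_prod d ss \<noteq> 0" and deg: "sum_list ss = d\<^sup>2" and pos: "\<And>s. s \<in> set ss \<Longrightarrow> 0 < s"
  shows "distinct ss" "set ss = (\<lambda>i. 2 * i + 1) ` {..<d}"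
proof -
  have "gen_trace d s \<noteq> 0" if "s \<in> set ss" for s
  proof
    assume "gen_trace d s = 0"
    moreover obtain xs ys where "ss = xs @ s # ys" using \<open>s \<in> set ss\<close> by (metis split_list)
    ultimately show False using nz by (simp add: trace_prod_def)
  qed
  then have odd: "odd s" and less: "s < 2 * d" if "s \<in> set ss" for s
    using gen_trace_even[of s d] gen_trace_eq_0[of d s] pos that by force+
  show dist: "distinct ss" using trace_prod_repeat_eq_0 nz odd by blast
  have sub: "set ss \<subseteq> (\<lambda>i. 2 * i + 1) ` {..<d}"
  proof
    fix s assume "s \<in> set ss"
    then have "s = 2 * (s div 2) + 1" "s div 2 < d"
      using odd[of s] less[of s] by (simp_all add: odd_two_times_div_two_succ less_mult_imp_div_less mult.commute)
    then show "s \<in> (\<lambda>i. 2 * i + 1) ` {..<d}" by blast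
  qed
  have "sum_list ss = \<Sum> (set ss)" using dist by (simp add: sum_list_distinct_conv_sum_set[of ss "\<lambda>x. x", simplified])
  moreover have "\<Sum> ((\<lambda>i. 2 * i + 1) ` {..<d}) = d\<^sup>2"
    using sum_odd[of d] by (subst sum.reindex) (auto simp: inj_on_def)
  moreover have "\<Sum> ((\<lambda>i. 2 * i + 1) ` {..<d}) = \<Sum> (set ss) + \<Sum> ((\<lambda>i. 2 * i + 1) ` {..<d} - set ss)"
    using sub by (subst add.commute, intro sum.subset_diff) auto
  ultimately have "\<Sum> ((\<lambda>i. 2 * i + 1) ` {..<d} - set ss) = 0" using deg by linarith
  then have "(\<lambda>i. 2 * i + 1) ` {..<d} - set ss = {}" by auto
  with sub show "set ss = (\<lambda>i. 2 * i + 1) ` {..<d}" by blast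
qed

section \<open>Nonvanishing products of entries\<close>

abbreviation entry_prod :: "nat \<Rightarrow> (nat \<times> nat \<times> nat) list \<Rightarrow> exterior" where
  "entry_prod d ts \<equiv> prod_list (map (\<lambda>(h, a, b). gen_pow d h a b) ts)"

abbreviation entries_ok :: "nat \<Rightarrow> (nat \<times> nat \<times> nat) list \<Rightarrow> bool" where
  "entries_ok d ts \<equiv> (\<forall>(h, a, b)\<in>set ts. a < d \<and> b < d)"

lemma homog_entry_prod: "entries_ok d ts \<Longrightarrow> homog d (sum_list (map fst ts)) (entry_prod d ts)"
  by (induction ts) (auto intro!: homog_mult homog_gen_pow)

text \<open>The factors are homogeneous, so reordering them changes the product only by a
  sign.\<close>

lemma entry_prod_permute:
  assumes "mset ts = mset ts'" "entries_ok d ts"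
  shows "entry_prod d ts = 0 \<longleftrightarrow> entry_prod d ts' = 0"
proof -
  have "\<exists>n. entry_prod d ts = (- 1) ^ n * entry_prod d ts'"
    using assms
  proof (induction ts' arbitrary: ts)
    case (Cons t ts')
    have "t \<in> set ts" using Cons.prems(1) by (metis list.set_intros(1) set_mset_mset)
    then obtain us vs where ts: "ts = us @ t # vs" by (metis split_list)
    obtain h a b where t: "t = (h, a, b)" by (cases t)
    have "mset (us @ vs) = mset ts'" using Cons.prems(1) ts by simp
    then obtain n where n: "entry_prod d (us @ vs) = (- 1) ^ n * entry_prod d ts'"
      using Cons.IH[of "us @ vs"] Cons.prems(2) ts by auto
    have ok: "entries_ok d us" "a < d" "b < d" using Cons.prems(2) ts t by auto
    have "homog d (sum_list (map fst us)) (entry_prod d us)" "homog d h (gen_pow d h a b)"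
      by (rule homog_entry_prod[OF ok(1)], rule homog_gen_pow[OF ok(2,3)])
    from homog_commute[OF this(2,1)] obtain k where
      k: "entry_prod d us * gen_pow d h a b = (- 1) ^ k * (gen_pow d h a b * entry_prod d us)" by blast
    have "entry_prod d ts = entry_prod d us * gen_pow d h a b * entry_prod d vs"
      by (simp add: ts t mult.assoc)
    also have "\<dots> = (- 1) ^ k * (gen_pow d h a b * entry_prod d (us @ vs))"
      unfolding k by (simp add: mult.assoc)
    also have "\<dots> = (- 1) ^ (k + n) * entry_prod d (t # ts')"
      unfolding n minus_one_power_left_commute[of "gen_pow d h a b"] by (simp add: t power_add mult.assoc)
    finally show ?case by blast
  qed (auto intro: exI[of _ 0])
  then show ?thesis by (auto simp: minus_one_power_eq_0_iff)
qed

text \<open>A multiset suffices, since the order of the factors affects only the sign.\<close>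

definition nonvanishing :: "nat \<Rightarrow> nat multiset \<Rightarrow> bool" where
  "nonvanishing d M \<longleftrightarrow> (\<exists>ts. image_mset fst (mset ts) = M \<and> entries_ok d ts \<and> entry_prod d ts \<noteq> 0)"

lemma mset_map_eqE:
  assumes "mset (map f xs) = mset ys"
  obtains xs' where "map f xs' = ys" "mset xs' = mset xs"
proof -
  have "\<exists>xs'. map f xs' = ys \<and> mset xs' = mset xs"
    using assms
  proof (induction ys arbitrary: xs)
    case (Cons y ys)
    then have "y \<in> f ` set xs" by (metis list.set_intros(1) set_mset_mset set_map)
    then obtain x where x: "x \<in> set xs" "y = f x" by blast
    have "mset (map f (remove1 x xs)) = mset ys"
      using Cons.prems x by (simp add: image_mset_Diff)
    then obtain xs' where "map f xs' = ys" "mset xs' = mset (remove1 x xs)" using Cons.IH by blast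
    then show ?case using x by (intro exI[of _ "x # xs'"]) simp
  qed simp
  then show thesis using that by blast
qed

lemma nonvanishing_mset:
  "nonvanishing d (mset hs) \<longleftrightarrow> (\<exists>ts. map fst ts = hs \<and> entries_ok d ts \<and> entry_prod d ts \<noteq> 0)"
proof
  assume "nonvanishing d (mset hs)"
  then obtain ts where ts: "mset (map fst ts) = mset hs" "entries_ok d ts" "entry_prod d ts \<noteq> 0"
    by (auto simp: nonvanishing_def)
  obtain ts' where "map fst ts' = hs" "mset ts' = mset ts" using ts(1) by (rule mset_map_eqE)
  moreover have "entry_prod d ts' \<noteq> 0" using entry_prod_permute[of ts ts' d] ts \<open>mset ts' = mset ts\<close> by simp
  moreover have "entries_ok d ts'" using ts(2) mset_eq_setD[OF \<open>mset ts' = mset ts\<close>] by simp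
  ultimately show "\<exists>ts. map fst ts = hs \<and> entries_ok d ts \<and> entry_prod d ts \<noteq> 0" by blast
next
  assume "\<exists>ts. map fst ts = hs \<and> entries_ok d ts \<and> entry_prod d ts \<noteq> 0"
  then obtain ts where "map fst ts = hs" "entries_ok d ts" "entry_prod d ts \<noteq> 0" by blast
  then show "nonvanishing d (mset hs)"
    unfolding nonvanishing_def by (intro exI[of _ ts]) auto
qed

lemma nonvanishing_empty: "nonvanishing d {#}"
  unfolding nonvanishing_def by (intro exI[of _ "[]"]) simp

lemma nonvanishing_mono:
  assumes "nonvanishing d M" "N \<subseteq># M"
  shows "nonvanishing d N"
proof -
  obtain hs where hs: "mset hs = N" using ex_mset by blast
  obtain ks where ks: "mset ks = M - N" using ex_mset by blast
  have "M = mset (hs @ ks)" using assms(2) hs ks by simp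
  with assms(1) obtain ts where ts: "map fst ts = hs @ ks" "entries_ok d ts" "entry_prod d ts \<noteq> 0"
    using nonvanishing_mset by metis
  obtain us vs where uv: "ts = us @ vs" "map fst us = hs" using ts(1) by (auto simp: map_eq_append_conv)
  then have "entry_prod d us \<noteq> 0" "entries_ok d us" using ts by auto
  then show ?thesis using uv(2) hs nonvanishing_mset by blast
qed

text \<open>Writing an entry of a power as a sum over the intermediate index \<open>c\<close>, some
  summand has to survive.\<close>

lemma nonvanishing_split:
  assumes "nonvanishing d (add_mset (h + k) M)"
  shows "nonvanishing d (add_mset h (add_mset k M))"
proof -
  obtain hs where hs: "mset hs = M" using ex_mset by blast
  have "nonvanishing d (mset ((h + k) # hs))" using assms hs by simp
  then obtain ts0 where ts0: "map fst ts0 = (h + k) # hs" "entries_ok d ts0" "entry_prod d ts0 \<noteq> 0"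
    using nonvanishing_mset by metis
  then obtain a b ts where ts: "ts0 = (h + k, a, b) # ts" "map fst ts = hs" by auto
  have ab: "a < d" "b < d" using ts0(2) ts(1) by auto
  have "(\<Sum>c<d. gen_pow d h a c * gen_pow d k c b * entry_prod d ts) \<noteq> 0"
    using ts0(3) ts(1) gen_pow_add[OF ab(1)] by (simp add: sum_distrib_right)
  then obtain c where c: "c < d" "gen_pow d h a c * gen_pow d k c b * entry_prod d ts \<noteq> 0"
    by (meson lessThan_iff sum.neutral)
  then have "entry_prod d ((h, a, c) # (k, c, b) # ts) \<noteq> 0" by (simp add: mult.assoc)
  moreover have "entries_ok d ((h, a, c) # (k, c, b) # ts)" using ts0(2) ts(1) c ab by auto
  ultimately have "nonvanishing d (mset (h # k # hs))"
    unfolding nonvanishing_mset using ts(2) by (intro exI[of _ "(h, a, c) # (k, c, b) # ts"]) simp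
  then show ?thesis using hs by simp
qed

lemma nonvanishing_divide:
  assumes "nonvanishing d (add_mset (q * m + r) M)"
  shows "nonvanishing d (replicate_mset q m + add_mset r M)"
  using assms
proof (induction q arbitrary: M)
  case (Suc q)
  then have "nonvanishing d (add_mset (m + (q * m + r)) M)" by (simp add: add.assoc)
  from nonvanishing_split[OF this] have "nonvanishing d (add_mset (q * m + r) (add_mset m M))"
    by (simp add: add_mset_commute)
  from Suc.IH[OF this] show ?case by simp
qed simp

lemma nonvanishing_divide_all:
  assumes "nonvanishing d (mset ss + M)"
  shows "nonvanishing d (replicate_mset (\<Sum>s\<leftarrow>ss. s div m) m + mset (map (\<lambda>s. s mod m) ss) + M)"
  using assms
proof (induction ss arbitrary: M)
  case (Cons s ss)
  have "nonvanishing d (add_mset ((s div m) * m + s mod m) (mset ss + M))" using Cons.prems by simp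
  from nonvanishing_divide[OF this] have "nonvanishing d (mset ss + (replicate_mset (s div m) m + add_mset (s mod m) M))" by (simp add: ac_simps)
  from Cons.IH[OF this] show ?case
    by (elim nonvanishing_mono) (simp add: multiset_eqI subseteq_mset_def)
qed simp

lemma nonvanishing_of_trace_prod:
  assumes "trace_prod d ss \<noteq> 0"
  shows "nonvanishing d (mset ss)"
proof -
  have "nonvanishing d (mset (map fst ts @ ss))" if "entries_ok d ts" "entry_prod d ts * trace_prod d ss \<noteq> 0" for ts ss
    using that
  proof (induction ss arbitrary: ts)
    case Nil
    then show ?case by (auto simp: nonvanishing_mset trace_prod_def simp del: mset_map)
  next
    case (Cons s ss)
    have "(\<Sum>a<d. entry_prod d ts * gen_pow d s a a * trace_prod d ss) \<noteq> 0"
      using Cons.prems(2) by (simp add: trace_prod_def gen_trace_def sum_distrib_left sum_distrib_right mult.assoc)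
    then obtain a where a: "a < d" "entry_prod d ts * gen_pow d s a a * trace_prod d ss \<noteq> 0"
      by (meson lessThan_iff sum.neutral)
    then have "entry_prod d (ts @ [(s, a, a)]) * trace_prod d ss \<noteq> 0" by simp
    moreover have "entries_ok d (ts @ [(s, a, a)])" using Cons.prems(1) a by auto
    ultimately have "nonvanishing d (mset (map fst (ts @ [(s, a, a)]) @ ss))" using Cons.IH by blast
    then show ?case by simp
  qed
  from this[of "[]" ss] assms show ?thesis by simp
qed

lemma nonvanishing_sum_le: "nonvanishing d M \<Longrightarrow> sum_mset M \<le> d\<^sup>2"
proof -
  assume "nonvanishing d M"
  then obtain ts where ts: "image_mset fst (mset ts) = M" "entries_ok d ts" "entry_prod d ts \<noteq> 0"
    by (auto simp: nonvanishing_def)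
  have "sum_list (map fst ts) \<le> d\<^sup>2" using homog_degree_le[OF homog_entry_prod] ts by blast
  then show ?thesis unfolding ts(1)[symmetric] by (metis mset_map sum_mset_sum_list)
qed

text \<open>Multiplying by well-chosen single entries reaches the top degree
  \<open>d\<^sup>2\<close>, where the invariance argument applies.\<close>

lemma nonvanishing_fill:
  assumes "nonvanishing d M"
  shows "nonvanishing d (M + replicate_mset (d\<^sup>2 - sum_mset M) 1)"
proof -
  have "nonvanishing d (M + replicate_mset n 1)" if "sum_mset M + n \<le> d\<^sup>2" for n
    using that
  proof (induction n)
    case 0
    then show ?case using assms by simp
  next
    case (Suc n)
    then have "nonvanishing d (M + replicate_mset n 1)" by simp
    then obtain ts where ts: "image_mset fst (mset ts) = M + replicate_mset n 1" "entries_ok d ts" "entry_prod d ts \<noteq> 0"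
      by (auto simp: nonvanishing_def)
    have "sum_list (map fst ts) = sum_mset (image_mset fst (mset ts))"
      by (metis mset_map sum_mset_sum_list)
    then have "sum_list (map fst ts) = sum_mset M + n" by (simp add: ts(1))
    then have hom: "homog d (sum_mset M + n) (entry_prod d ts)" using homog_entry_prod[OF ts(2)] by simp
    have "sum_mset M + n < d\<^sup>2" using Suc.prems by simp
    from ex_gen_mult_nonzero[OF hom ts(3) this]
    obtain a b where ab: "a < d" "b < d" "entry_prod d ts * gen (a, b) \<noteq> 0" by blast
    have "gen_pow d 1 a b = gen (a, b)" using gen_pow_1[OF ab(2), of a] by (simp only: One_nat_def)
    then have "entry_prod d (ts @ [(1, a, b)]) \<noteq> 0" using ab(3) by (simp del: One_nat_def)
    moreover have "entries_ok d (ts @ [(1, a, b)])" using ts(2) ab by simp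
    moreover have "image_mset fst (mset (ts @ [(1, a, b)])) = M + replicate_mset (Suc n) 1" using ts(1) by simp
    ultimately show ?case unfolding nonvanishing_def by blast
  qed
  then show ?thesis using nonvanishing_sum_le[OF assms] by simp
qed

text \<open>The packing condition in numerical form: the parts are grouped into bins of sizes 1, 3,
  ..., \<open>2 * d - 1\<close>, and a bin \<open>s\<close> receives a total weight \<open>v\<close>
  with \<open>v * c \<le> s\<close>.\<close>

lemma nonvanishing_weights:
  assumes nv: "nonvanishing d M" and deg: "sum_mset M = d\<^sup>2"
    and M: "\<forall>h\<in>#M. 0 < h \<and> w h * c \<le> h"
  shows "\<exists>ts :: (nat \<times> nat) list. trace_prod d (map fst ts) \<noteq> 0 \<and> distinct (map fst ts) \<and>
    fst ` set ts = (\<lambda>i. 2 * i + 1) ` {..<d} \<and> sum_list (map snd ts) = (\<Sum>h\<in>#M. w h) \<and>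
    (\<forall>(s, v)\<in>set ts. v * c \<le> s)"
proof -
  obtain es where es: "image_mset fst (mset es) = M" "entries_ok d es" "entry_prod d es \<noteq> 0"
    using nv by (auto simp: nonvanishing_def)
  define n where "n = length es"
  define h where "h = (\<lambda>j. fst (es ! j))"
  define a where "a = (\<lambda>j. fst (snd (es ! j)))"
  define b where "b = (\<lambda>j. snd (snd (es ! j)))"
  \<comment> \<open>Factors are labelled by their positions, because equal factors still need
    distinct labels.\<close>
  have es_map: "es = map (\<lambda>j. (h j, a j, b j)) [0..<n]"
    by (rule nth_equalityI) (simp_all add: n_def h_def a_def b_def)
  have M_eq: "M = mset (map h [0..<n])" using es(1) by (subst (asm) es_map) (simp add: image_mset.compositionality o_def)
  have hM: "h j \<in># M" if "j < n" for j using that unfolding M_eq by simp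
  have "\<exists>ts'. trace_prod d (map fst ts') \<noteq> 0 \<and> sum_list (map fst ts') = d\<^sup>2 \<and>
      sum_list (map snd ts') = sum_list (map (\<lambda>j. w (h j)) [0..<n]) + sum_list (map snd ([] :: (nat \<times> nat) list)) \<and>
      (\<forall>(s, v)\<in>set ts'. 0 < s \<and> v * c \<le> s)"
  proof (rule tprod_reduce_to_traces)
    show "a j < d \<and> b j < d" if "j \<in> set [0..<n]" for j
    proof -
      have "(h j, a j, b j) \<in> set es" using that by (subst es_map) auto
      then show ?thesis using es(2) by auto
    qed
    show "tprod d h [0..<n] a b * trace_prod d (map fst []) \<noteq> 0"
      using es(3) by (subst (asm) es_map) (simp add: tprod_def trace_prod_def o_def)
    show "sum_list (map h [0..<n]) + sum_list (map fst []) = d\<^sup>2"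
      using deg unfolding M_eq sum_mset_sum_list by simp
    show "0 < h j \<and> w (h j) * c \<le> h j" if "j \<in> set [0..<n]" for j
      using M hM that by simp
  qed auto
  then obtain ts' where ts': "trace_prod d (map fst ts') \<noteq> 0" "sum_list (map fst ts') = d\<^sup>2"
      "sum_list (map snd ts') = sum_list (map (\<lambda>j. w (h j)) [0..<n])"
      "\<And>s v. (s, v) \<in> set ts' \<Longrightarrow> 0 < s \<and> v * c \<le> s"
    by auto
  have pos: "0 < s" if "s \<in> set (map fst ts')" for s using ts'(4) that by auto
  have "sum_list (map snd ts') = (\<Sum>h\<in>#M. w h)"
    unfolding M_eq ts'(3) mset_map[symmetric] sum_mset_sum_list by (simp add: o_def)
  moreover have "fst ` set ts' = (\<lambda>i. 2 * i + 1) ` {..<d}" "distinct (map fst ts')"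
    using trace_prod_top_nonzero[OF ts'(1,2) pos] by simp_all
  ultimately show ?thesis using ts'(1,4) by blast
qed

section \<open>Packing the parts \<open>m\<close> and \<open>m - 1\<close> into the odd bins\<close>

lemma bracket_altdef: "bracket d m = (\<Sum>i<d. (2 * i + 1) div m)"
  unfolding bracket_def
proof (rule sum.reindex_bij_witness[of _ Suc "\<lambda>i. i - 1"])
  fix i assume "i \<in> {1..d}"
  then have "2 * (i - 1) + 1 = 2 * i - 1" by auto
  then show "(2 * (i - 1) + 1) div m = (2 * i - 1) div m" by (rule arg_cong)
qed auto

text \<open>A group of parts whose sum is an odd number \<open>s < 2 d\<close> contains at most \<open>s div m\<close> parts
  \<open>\<ge> m - 1\<close>, because two of them would already add up to \<open>2 (m - 1) \<ge> 2 d\<close>.\<close>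

lemma vanishing_partition:
  assumes "odd m" "d < m" "0 < d"
  shows "\<not> nonvanishing d (mset (thm_partition d m))"
proof
  assume nv: "nonvanishing d (mset (thm_partition d m))"
  have m: "3 \<le> m" using assms by (cases "m = 2") auto
  define M where "M = mset (thm_partition d m)"
  define N where "N = M + replicate_mset (d\<^sup>2 - sum_mset M) 1"
  \<comment> \<open>With \<open>c\<close> = \<open>m - 1\<close> this weight counts the parts
    \<open>m\<close> and \<open>m - 1\<close>; the filling parts 1 have weight 0, as
    \<open>m\<close> is at least 3.\<close>
  define w where "w = (\<lambda>h. if m - 1 \<le> h then 1 else 0 :: nat)"
  have M: "M = add_mset (m - 1) (replicate_mset (bracket d m) m)"
    using m by (simp add: M_def thm_partition_def)
  have nvN: "nonvanishing d N" using nonvanishing_fill nv by (simp add: N_def M_def)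
  have deg: "sum_mset N = d\<^sup>2" using nonvanishing_sum_le nv by (simp add: N_def M_def)
  have wN: "\<forall>h\<in>#N. 0 < h \<and> w h * (m - 1) \<le> h"
    using m by (auto simp: N_def M w_def split: if_splits)
  from nonvanishing_weights[of d N w "m - 1", OF nvN deg wN]
  obtain ts :: "(nat \<times> nat) list" where
    ts: "distinct (map fst ts)" "fst ` set ts = (\<lambda>i. 2 * i + 1) ` {..<d}"
      "sum_list (map snd ts) = (\<Sum>h\<in>#N. w h)" "\<forall>(s, v)\<in>set ts. v * (m - 1) \<le> s"
    by (elim exE conjE) (rule that)
  have "v \<le> s div m" if sv: "(s, v) \<in> set ts" for s v
  proof -
    have "s \<in> fst ` set ts" using sv by (rule image_eqI[rotated]) simp
    then obtain i where s: "s = 2 * i + 1" "i < d" unfolding ts(2) by blast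
    have le: "v * (m - 1) \<le> s" using ts(4) sv by auto
    have v: "v < 2"
    proof (rule ccontr)
      assume "\<not> v < 2"
      then have "2 * (m - 1) \<le> v * (m - 1)" by (intro mult_right_mono) auto
      with le s assms show False by linarith
    qed
    \<comment> \<open>Parity: the bin size \<open>s\<close> is odd and \<open>m - 1\<close> is even,
      so a bin that holds \<open>m - 1\<close> has room for \<open>m\<close>.\<close>
    have ms: "m \<le> s" if "v = 1"
    proof -
      have "m - 1 \<le> s" "even (m - 1)" "odd s" using le that s assms by auto
      then have "m - 1 \<noteq> s" by auto
      with \<open>m - 1 \<le> s\<close> show ?thesis by linarith
    qed
    show ?thesis
    proof (cases "v = 0")
      case False
      with v have "v = 1" by simp
      then have "0 < s div m" using ms m by (simp add: div_greater_zero_iff)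
      with \<open>v = 1\<close> show ?thesis by simp
    qed simp
  qed
  then have "sum_list (map snd ts) \<le> sum_list (map (\<lambda>t. fst t div m) ts)"
    by (intro sum_list_mono) auto
  also have "\<dots> = sum_list (map (\<lambda>s. s div m) (map fst ts))" by (simp add: o_def)
  also have "\<dots> = (\<Sum>s\<in>(\<lambda>i. 2 * i + 1) ` {..<d}. s div m)"
    using ts(1,2) by (subst sum_list_distinct_conv_sum_set) auto
  also have "\<dots> = bracket d m"
    unfolding bracket_altdef by (subst sum.reindex) (auto simp: inj_on_def)
  \<comment> \<open>The total weight is \<open>bracket d m + 1\<close>, one more than the bins can
    take.\<close>
  finally show False using m unfolding ts(3) by (simp add: N_def M w_def)
qed

text \<open>Filling up the empty product gives \<open>d\<^sup>2\<close> single entries with nonzero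
  product. Reducing it to traces can only end in tr X * tr X^3 * ... * tr X^(2d-1), which is
  therefore nonzero, and some product of diagonal entries of these powers survives.\<close>

lemma nonvanishing_odd:
  assumes "0 < d"
  shows "nonvanishing d (mset (map (\<lambda>i. 2 * i + 1) [0..<d]))"
proof -
  define N where "N = replicate_mset (d\<^sup>2) (1::nat)"
  have nv: "nonvanishing d N" using nonvanishing_fill[OF nonvanishing_empty, of d] by (simp add: N_def)
  have "sum_mset N = d\<^sup>2" by (simp add: N_def)
  moreover have "\<forall>h\<in>#N. 0 < h \<and> 0 * 0 \<le> h" by (auto simp: N_def split: if_splits)
  ultimately have "\<exists>ts :: (nat \<times> nat) list. trace_prod d (map fst ts) \<noteq> 0 \<and> distinct (map fst ts) \<and>
    fst ` set ts = (\<lambda>i. 2 * i + 1) ` {..<d} \<and> sum_list (map snd ts) = (\<Sum>h\<in>#N. 0) \<and>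
    (\<forall>(s, v)\<in>set ts. v * 0 \<le> s)"
    by (rule nonvanishing_weights[of d N "\<lambda>_. 0" 0, OF nv])
  then obtain ts :: "(nat \<times> nat) list" where ts: "trace_prod d (map fst ts) \<noteq> 0" "distinct (map fst ts)"
      "fst ` set ts = (\<lambda>i. 2 * i + 1) ` {..<d}"
    by (elim exE conjE) (rule that)
  have "mset (map fst ts) = mset (map (\<lambda>i. 2 * i + 1) [0..<d])"
    using ts(2,3) by (subst set_eq_iff_mset_eq_distinct[symmetric]) (auto simp: distinct_map inj_on_def)
  then show ?thesis using nonvanishing_of_trace_prod[OF ts(1)] by simp
qed

text \<open>Each odd part is cut into parts \<open>m\<close> and a remainder. This yields
  \<open>bracket d m\<close> parts \<open>m\<close>; the remainder \<open>m - 1\<close> of bin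
  \<open>2 * i + 1\<close> is kept and the others are dropped.\<close>

lemma nonvanishing_partition:
  assumes "0 < d" "0 < m" "i < d" "(2 * i + 1) mod m = m - 1"
  shows "nonvanishing d (mset (thm_partition d m))"
proof -
  let ?ss = "map (\<lambda>i. 2 * i + 1) [0..<d]"
  have "nonvanishing d (replicate_mset (\<Sum>s\<leftarrow>?ss. s div m) m + mset (map (\<lambda>s. s mod m) ?ss) + {#})"
    using nonvanishing_divide_all[of d ?ss "{#}" m] nonvanishing_odd[OF assms(1)] by simp
  moreover have "(\<Sum>s\<leftarrow>?ss. s div m) = bracket d m"
    by (simp add: bracket_altdef o_def interv_sum_list_conv_sum_set_nat atLeast0LessThan)
  moreover have "m - 1 \<in># mset (map (\<lambda>s. s mod m) ?ss)"
    using assms(3,4) by force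
  then have "{#m - 1#} \<subseteq># mset (map (\<lambda>s. s mod m) ?ss)" by simp
  ultimately have "nonvanishing d (replicate_mset (bracket d m) m + {#m - 1#})"
    by (elim nonvanishing_mono) (simp add: subset_mset.add_left_mono)
  \<comment> \<open>An inclusion and not an equality: for \<open>m\<close> = 1 the partition omits
    the part 0.\<close>
  then show ?thesis by (rule nonvanishing_mono) (simp add: thm_partition_def)
qed

lemma nonvanishing_partition_iff:
  assumes "0 < d" "0 < m" "m \<le> 2 * d"
  shows "nonvanishing d (mset (thm_partition d m)) \<longleftrightarrow> even m \<or> odd m \<and> m \<le> d"
proof
  assume "nonvanishing d (mset (thm_partition d m))"
  then show "even m \<or> odd m \<and> m \<le> d"
    using vanishing_partition[of m d] assms by force
next
  assume "even m \<or> odd m \<and> m \<le> d"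
  then show "nonvanishing d (mset (thm_partition d m))"
  proof
    assume "even m"
    \<comment> \<open>For even \<open>m\<close> the number \<open>m - 1\<close> is itself an odd bin
      size below \<open>2 * d\<close>.\<close>
    then have "2 * (m div 2 - 1) + 1 = m - 1" "m div 2 - 1 < d" using assms by auto
    then show ?thesis using assms by (intro nonvanishing_partition[of d m "m div 2 - 1"]) auto
  next
    assume m: "odd m \<and> m \<le> d"
    \<comment> \<open>For odd \<open>m\<close> the bin \<open>2 * m - 1\<close> leaves the remainder
      \<open>m - 1\<close>; it is available as \<open>m \<le> d\<close>.\<close>
    have "2 * (m - 1) + 1 = (m - 1) + m" using assms by simp
    then have "(2 * (m - 1) + 1) mod m = m - 1" using assms by (simp only: mod_add_self2) simp
    then show ?thesis using assms m by (intro nonvanishing_partition[of d m "m - 1"]) auto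
  qed
qed

section \<open>Evaluations of ST\<close>

abbreviation word_prod :: "(nat \<times> nat) list \<Rightarrow> exterior" where
  "word_prod w \<equiv> prod_list (map gen w)"

lemma coef_word_prod_nonzero: "coef (word_prod w) S \<noteq> 0 \<Longrightarrow> S = set w"
proof (induction w arbitrary: S)
  case Nil
  then show ?case by (simp add: one_exterior.rep_eq split: if_splits)
next
  case (Cons c w)
  then have "c \<in> S" "coef (word_prod w) (S - {c}) \<noteq> 0" by (auto simp: coef_gen_mult split: if_splits)
  then have "S - {c} = set w" using Cons.IH by blast
  then show ?case using \<open>c \<in> S\<close> by auto
qed

lemma coef_word_prod_square:
  assumes "distinct w"
  shows "coef (word_prod w) (set w) * coef (word_prod w) (set w) = 1"
  using assms
proof (induction w)
  case (Cons c w)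
  then have "insert c (set w) - {c} = set w" by auto
  then show ?case using Cons by (simp add: coef_gen_mult mult_ac)
qed (simp add: one_exterior.rep_eq)

lemma gen_word_prod_commute: "gen c * word_prod w = (- 1) ^ length w * (word_prod w * gen c)"
proof (induction w)
  case (Cons e w)
  have "grade_inv (gen e) = - gen e"
    by (rule exterior_eqI) (auto simp: grade_inv.rep_eq gen.rep_eq)
  then have "gen c * gen e = - (gen e * gen c)" using gen_commute[of c "gen e"] by simp
  then have "gen c * word_prod (e # w) = - (gen e * (gen c * word_prod w))"
    by (simp add: mult.assoc[symmetric])
  then show ?case using Cons by (simp add: mult.assoc minus_one_power_left_commute[of "gen e"])
qed simp

lemma word_prod_swap: "word_prod (xs @ x # ys @ y # zs) = - word_prod (xs @ y # ys @ x # zs)"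
proof -
  have "gen x * word_prod ys * gen y = - (gen y * word_prod ys * gen x)"
  proof -
    have "gen y * word_prod ys * gen x = (- 1) ^ length ys * (word_prod ys * (gen y * gen x))"
      unfolding gen_word_prod_commute by (simp add: mult.assoc)
    moreover have "gen x * word_prod ys * gen y = (- 1) ^ length ys * (word_prod ys * (gen x * gen y))"
      unfolding gen_word_prod_commute by (simp add: mult.assoc)
    moreover have "gen x * gen y = - (gen y * gen x)" using gen_word_prod_commute[of x "[y]"] by simp
    ultimately show ?thesis by simp
  qed
  then have "gen x * word_prod ys * gen y * word_prod zs = - (gen y * word_prod ys * gen x * word_prod zs)" by simp
  then show ?thesis by (simp add: mult.assoc)
qed

lemma permute_list_transpose:
  assumes "i < j" "j < length w"
  obtains xs x ys y zs where "w = xs @ x # ys @ y # zs"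
    "permute_list (Transposition.transpose i j) w = xs @ y # ys @ x # zs"
proof -
  define xs ys zs where "xs = take i w" and "ys = take (j - Suc i) (drop (Suc i) w)" and "zs = drop (Suc j) w"
  have 1: "w = xs @ w ! i # drop (Suc i) w" using id_take_nth_drop[of i w] assms by (simp add: xs_def)
  have "drop (Suc i) w = ys @ drop (Suc i) w ! (j - Suc i) # drop (Suc (j - Suc i)) (drop (Suc i) w)"
    using id_take_nth_drop[of "j - Suc i" "drop (Suc i) w"] assms by (simp add: ys_def)
  then have 2: "drop (Suc i) w = ys @ w ! j # zs" using assms by (simp add: zs_def)
  have w: "w = xs @ w ! i # ys @ w ! j # zs" using 1 2 by simp
  have len: "length xs = i" "length ys = j - Suc i" using assms by (auto simp: xs_def ys_def)
  have "permute_list (Transposition.transpose i j) w = xs @ w ! j # ys @ w ! i # zs"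
  proof (rule nth_equalityI)
    show "length (permute_list (Transposition.transpose i j) w) = length (xs @ w ! j # ys @ w ! i # zs)"
      using arg_cong[OF w, of length] by simp
    fix k assume "k < length (permute_list (Transposition.transpose i j) w)"
    then have k: "k < length w" by simp
    have wk: "w ! k = (xs @ w ! i # ys @ w ! j # zs) ! k" using w by simp
    have "permute_list (Transposition.transpose i j) w ! k = w ! Transposition.transpose i j k"
      using k by (simp add: permute_list_def)
    also have "\<dots> = (xs @ w ! j # ys @ w ! i # zs) ! k"
    proof (cases "k = i \<or> k = j")
      case True
      then show ?thesis using assms len by (auto simp: nth_append nth_Cons')
    next
      case False
      then have "(xs @ w ! i # ys @ w ! j # zs) ! k = (xs @ w ! j # ys @ w ! i # zs) ! k"
        using assms len by (auto simp: nth_append nth_Cons')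
      then show ?thesis using False wk by (simp add: transpose_apply_other)
    qed
    finally show "permute_list (Transposition.transpose i j) w ! k = (xs @ w ! j # ys @ w ! i # zs) ! k" .
  qed
  then show thesis using that w by blast
qed

text \<open>Induction over transpositions: exchanging two letters of a word changes the sign by
  \<open>word_prod_swap\<close>.\<close>

lemma word_prod_permute:
  assumes "p permutes {..<length w}"
  shows "word_prod (permute_list p w) = of_int (sign p) * word_prod w"
  using finite_lessThan assms
proof (induction rule: permutes_rev_induct)
  case (swap i j p)
  let ?t = "Transposition.transpose i j"
  have t: "?t permutes {..<length w}" using swap by (intro permutes_swap_id)
  have "word_prod (permute_list ?t v) = - word_prod v" if "length v = length w" for v
  proof (cases "i < j")
    case True
    then obtain xs x ys y zs where "v = xs @ x # ys @ y # zs" "permute_list ?t v = xs @ y # ys @ x # zs"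
      using permute_list_transpose[of i j v] swap.hyps(2) \<open>length v = length w\<close> by (metis lessThan_iff)
    then show ?thesis using word_prod_swap by metis
  next
    case False
    then have "j < i" using swap.hyps(3) by simp
    then obtain xs x ys y zs where "v = xs @ x # ys @ y # zs" "permute_list ?t v = xs @ y # ys @ x # zs"
      using permute_list_transpose[of j i v] swap.hyps(1) \<open>length v = length w\<close>
      by (metis lessThan_iff transpose_commute)
    then show ?thesis using word_prod_swap by metis
  qed
  moreover have "sign (p \<circ> ?t) = - sign p"
    using swap.hyps t by (subst sign_compose) (auto simp: sign_swap_id intro: permutes_imp_permutation[of "{..<length w}"])
  moreover have "word_prod (permute_list (p \<circ> ?t) w) = word_prod (permute_list ?t (permute_list p w))"
    by (simp only: permute_list_compose[OF t])
  ultimately show ?case using swap.IH by (simp del: o_apply)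
qed simp

lemma word_prod_not_distinct:
  assumes "\<not> distinct w"
  shows "word_prod w = 0"
proof -
  obtain xs x ys zs where w: "w = xs @ [x] @ ys @ [x] @ zs" using not_distinct_decomp[OF assms] by blast
  have "word_prod w = - word_prod w" using word_prod_swap[of xs x ys x zs] by (simp add: w)
  then show ?thesis by (rule exterior_self_neg_eq_0)
qed

text \<open>The determinant of the square array whose rows are the matrices \<open>A s\<close> and
  whose columns are the coordinates \<open>w ! t\<close>.\<close>

definition alt_eval :: "(nat \<Rightarrow> 'a::comm_ring_1 mat) \<Rightarrow> (nat \<times> nat) list \<Rightarrow> 'a" where
  "alt_eval A w = (\<Sum>p | p permutes {0..<length w}. of_int (sign p) * (\<Prod>t<length w. A (p t) $$ (w ! t)))"

lemma alt_eval_permute: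
  assumes q: "q permutes {..<length w}"
  shows "alt_eval A (permute_list q w) = of_int (sign q) * alt_eval A w"
proof -
  have q0: "q permutes {0..<length w}" using q by (simp add: atLeast0LessThan)
  have "alt_eval A (permute_list q w) = (\<Sum>p | p permutes {0..<length w}.
      of_int (sign p) * (\<Prod>t<length w. A (p t) $$ (w ! q t)))"
    unfolding alt_eval_def by (intro sum.cong) (auto simp: permute_list_def)
  also have "\<dots> = (\<Sum>p | p permutes {0..<length w}.
      of_int (sign (p \<circ> q)) * (\<Prod>t<length w. A (p (q t)) $$ (w ! q t)))"
    by (subst sum_permutations_compose_right[OF q0]) simp
  also have "\<dots> = (\<Sum>p | p permutes {0..<length w}.
      of_int (sign q) * (of_int (sign p) * (\<Prod>t<length w. A (p t) $$ (w ! t))))"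
  proof (rule sum.cong[OF refl])
    fix p assume "p \<in> {p. p permutes {0..<length w}}"
    then have "sign (p \<circ> q) = sign p * sign q"
      using q0 by (intro sign_compose permutes_imp_permutation[of "{0..<length w}"]) auto
    moreover have "(\<Prod>t<length w. A (p (q t)) $$ (w ! q t)) = (\<Prod>t<length w. A (p t) $$ (w ! t))"
      using prod.permute[OF q, of "\<lambda>t. A (p t) $$ (w ! t)"] by (simp add: o_def)
    ultimately show "of_int (sign (p \<circ> q)) * (\<Prod>t<length w. A (p (q t)) $$ (w ! q t)) =
        of_int (sign q) * (of_int (sign p) * (\<Prod>t<length w. A (p t) $$ (w ! t)))"
      by (simp add: mult_ac)
  qed
  finally show ?thesis by (simp add: alt_eval_def sum_distrib_left)
qed

lemma alt_eval_not_distinct: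
  fixes A :: "nat \<Rightarrow> 'a::field_char_0 mat"
  assumes "\<not> distinct w"
  shows "alt_eval A w = 0"
proof -
  obtain i j where ij: "i < length w" "j < length w" "i \<noteq> j" "w ! i = w ! j"
    using assms by (auto simp: distinct_conv_nth)
  let ?t = "Transposition.transpose i j"
  have t: "?t permutes {..<length w}" using ij by (intro permutes_swap_id) auto
  have "permute_list ?t w = w"
    by (rule nth_equalityI) (use ij in \<open>auto simp: permute_list_def Transposition.transpose_def\<close>)
  then have "alt_eval A w = - alt_eval A w" using alt_eval_permute[OF t, of A] ij by (simp add: sign_swap_id)
  then show ?thesis by simp
qed

abbreviation set_word :: "(nat \<times> nat) set \<Rightarrow> (nat \<times> nat) list" where
  "set_word S \<equiv> sorted_list_of_set S"

text \<open>The linear functional on degree \<open>k\<close> with \<open>x\<^sub>w \<mapsto> alt_eval A w\<close>; the factor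
  \<open>coef (word_prod (set_word S)) S\<close> is a sign.\<close>

definition ext_eval :: "nat \<Rightarrow> nat \<Rightarrow> (nat \<Rightarrow> 'a::comm_ring_1 mat) \<Rightarrow> exterior \<Rightarrow> 'a" where
  "ext_eval d k A f = (\<Sum>S | S \<subseteq> {..<d} \<times> {..<d} \<and> card S = k.
     of_int (coef f S * coef (word_prod (set_word S)) S) * alt_eval A (set_word S))"

lemma ext_eval_0 [simp]: "ext_eval d k A 0 = 0"
  and ext_eval_add: "ext_eval d k A (f + g) = ext_eval d k A f + ext_eval d k A g"
  by (simp_all add: ext_eval_def sum.distrib distrib_right)

lemma ext_eval_sum_list: "ext_eval d k A (\<Sum>x\<leftarrow>xs. f x) = (\<Sum>x\<leftarrow>xs. ext_eval d k A (f x))"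
  by (induction xs) (simp_all add: ext_eval_add)

text \<open>Both sides are alternating in \<open>w\<close>. A repeated letter makes both vanish, and
  sorting a word with distinct letters introduces the same sign in \<open>word_prod\<close> and
  \<open>alt_eval\<close>.\<close>

lemma ext_eval_word_prod:
  fixes A :: "nat \<Rightarrow> 'a::field_char_0 mat"
  assumes w: "set w \<subseteq> {..<d} \<times> {..<d}" "length w = k"
  shows "ext_eval d k A (word_prod w) = alt_eval A w"
proof (cases "distinct w")
  case False
  then show ?thesis by (simp add: word_prod_not_distinct alt_eval_not_distinct)
next
  case True
  let ?e = "set_word (set w)"
  have S: "set w \<in> {S. S \<subseteq> {..<d} \<times> {..<d} \<and> card S = k}" using w True by (simp add: distinct_card)
  have fin: "finite {S. S \<subseteq> {..<d} \<times> {..<d} \<and> card S = k}" by (rule finite_subset[of _ "Pow ({..<d} \<times> {..<d})"]) auto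
  have "mset ?e = mset w" using True by (intro set_eq_iff_mset_eq_distinct[THEN iffD1]) auto
  then obtain p where p: "p permutes {..<length w}" "permute_list p w = ?e" by (rule mset_eq_permutation)
  have pm: "word_prod ?e = of_int (sign p) * word_prod w" "alt_eval A ?e = of_int (sign p) * alt_eval A w"
    using word_prod_permute[OF p(1)] alt_eval_permute[OF p(1), of A] p(2) by simp_all
  have "coef (of_int s * f) S = s * coef f S" for s f S
    by (cases s rule: int_cases2) (simp_all add: coef_of_nat_mult)
  then have ce: "coef (word_prod ?e) (set w) = sign p * coef (word_prod w) (set w)" by (simp add: pm(1))
  have "ext_eval d k A (word_prod w) =
      (\<Sum>S\<in>{set w}. of_int (coef (word_prod w) S * coef (word_prod (set_word S)) S) * alt_eval A (set_word S))"
    unfolding ext_eval_def using S fin coef_word_prod_nonzero[of w]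
    by (intro sum.mono_neutral_right) auto
  also have "\<dots> = of_int (coef (word_prod w) (set w) * coef (word_prod w) (set w)) * (of_int (sign p) * of_int (sign p)) * alt_eval A w"
    by (simp add: ce pm(2) mult_ac)
  also have "of_int (sign p) * of_int (sign p) = (1 :: 'a)" by (metis of_int_1 of_int_mult sign_idempotent)
  finally show ?thesis using coef_word_prod_square[OF True] by simp
qed

section \<open>Expanding matrix products along paths\<close>

text \<open>The edge words of the walks of length \<open>h\<close> from \<open>a\<close> to
  \<open>b\<close> in the complete digraph with loops on \<open>d\<close> vertices; they index the
  terms of an entry of a product of \<open>h\<close> matrices.\<close>

fun paths :: "nat \<Rightarrow> nat \<Rightarrow> nat \<Rightarrow> nat \<Rightarrow> (nat \<times> nat) list list" where
  "paths d 0 a b = (if a = b then [[]] else [])"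
| "paths d (Suc h) a b = concat (map (\<lambda>c. map ((#) (a, c)) (paths d h c b)) [0..<d])"

fun path_words :: "nat \<Rightarrow> nat list \<Rightarrow> (nat \<Rightarrow> nat \<times> nat) \<Rightarrow> (nat \<times> nat) list list" where
  "path_words d [] ab = [[]]"
| "path_words d (h # lam) ab = concat (map (\<lambda>u. map ((@) u) (path_words d lam (\<lambda>j. ab (Suc j))))
     (paths d h (fst (ab 0)) (snd (ab 0))))"

lemma sum_list_concat_map: "(\<Sum>x\<leftarrow>concat (map F xs). f x) = (\<Sum>y\<leftarrow>xs. \<Sum>x\<leftarrow>F y. f x)"
  for f :: "'b \<Rightarrow> 'c::comm_monoid_add"
  by (induction xs) simp_all

lemma length_paths: "w \<in> set (paths d h a b) \<Longrightarrow> length w = h"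
  by (induction h arbitrary: a w) (auto split: if_splits)

lemma set_paths: "w \<in> set (paths d h a b) \<Longrightarrow> a < d \<Longrightarrow> set w \<subseteq> {..<d} \<times> {..<d}"
  by (induction h arbitrary: a w) (fastforce split: if_splits)+

lemma length_path_words: "w \<in> set (path_words d lam ab) \<Longrightarrow> length w = sum_list lam"
  by (induction lam arbitrary: ab w) (auto simp: length_paths)

lemma set_path_words:
  "w \<in> set (path_words d lam ab) \<Longrightarrow> (\<And>j. j < length lam \<Longrightarrow> fst (ab j) < d) \<Longrightarrow> set w \<subseteq> {..<d} \<times> {..<d}"
proof (induction lam arbitrary: ab w)
  case (Cons h lam)
  from Cons.prems(1) obtain u v where uv: "w = u @ v" "u \<in> set (paths d h (fst (ab 0)) (snd (ab 0)))"
      "v \<in> set (path_words d lam (\<lambda>j. ab (Suc j)))" by auto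
  have "set u \<subseteq> {..<d} \<times> {..<d}" using uv(2) Cons.prems(2)[of 0] by (intro set_paths) auto
  moreover have "set v \<subseteq> {..<d} \<times> {..<d}" using uv(3) Cons.prems(2) by (intro Cons.IH) auto
  ultimately show ?case using uv(1) by simp
qed simp

lemma gen_pow_paths: "gen_pow d h a b = (\<Sum>w\<leftarrow>paths d h a b. word_prod w)"
proof (induction h arbitrary: a)
  case (Suc h)
  have "(\<Sum>w\<leftarrow>paths d (Suc h) a b. word_prod w) = (\<Sum>c\<leftarrow>[0..<d]. gen (a, c) * gen_pow d h c b)"
    by (simp add: sum_list_concat_map o_def Suc sum_list_const_mult)
  then show ?case by (simp add: interv_sum_list_conv_sum_set_nat atLeast0LessThan)
qed simp

lemma entry_prod_path_words:
  "entry_prod d (map (\<lambda>j. (lam ! j, ab j)) [0..<length lam]) = (\<Sum>w\<leftarrow>path_words d lam ab. word_prod w)"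
proof (induction lam arbitrary: ab)
  case (Cons h lam)
  have eq: "map (\<lambda>j. ((h # lam) ! j, ab j)) [0..<length (h # lam)] =
      (h, ab 0) # map (\<lambda>j. (lam ! j, ab (Suc j))) [0..<length lam]"
    by (simp add: map_upt_Suc del: upt_Suc)
  have "entry_prod d (map (\<lambda>j. ((h # lam) ! j, ab j)) [0..<length (h # lam)]) =
      gen_pow d h (fst (ab 0)) (snd (ab 0)) * (\<Sum>w\<leftarrow>path_words d lam (\<lambda>j. ab (Suc j)). word_prod w)"
    unfolding eq list.map prod_list.Cons Cons.IH by (simp add: case_prod_unfold)
  also have "\<dots> = (\<Sum>u\<leftarrow>paths d h (fst (ab 0)) (snd (ab 0)). \<Sum>w\<leftarrow>path_words d lam (\<lambda>j. ab (Suc j)). word_prod u * word_prod w)"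
    by (simp add: gen_pow_paths sum_list_const_mult sum_list_mult_const[symmetric])
  also have "\<dots> = (\<Sum>w\<leftarrow>path_words d (h # lam) ab. word_prod w)"
    by (simp add: sum_list_concat_map o_def)
  finally show ?case .
qed simp

lemma mat_list_prod_carrier:
  "(\<And>M. M \<in> set Ms \<Longrightarrow> M \<in> carrier_mat d d) \<Longrightarrow> mat_list_prod d Ms \<in> carrier_mat d d"
  by (induction Ms) (auto simp: mat_list_prod_def intro!: mult_carrier_mat)

lemma mat_list_prod_paths:
  fixes B :: "nat \<Rightarrow> 'a::comm_ring_1 mat"
  assumes "\<And>t. t < s + h \<Longrightarrow> B t \<in> carrier_mat d d" "a < d" "b < d"
  shows "mat_list_prod d (map B [s..<s + h]) $$ (a, b) =
    (\<Sum>w\<leftarrow>paths d h a b. \<Prod>t<h. B (s + t) $$ (w ! t))"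
  using assms
proof (induction h arbitrary: s a)
  case 0
  then show ?case by (simp add: mat_list_prod_def)
next
  case (Suc h)
  let ?R = "mat_list_prod d (map B [Suc s..<Suc s + h])"
  have R: "?R \<in> carrier_mat d d" by (rule mat_list_prod_carrier) (use Suc.prems(1) in auto)
  have Bs: "B s \<in> carrier_mat d d" using Suc.prems(1) by simp
  have "[s..<s + Suc h] = s # [Suc s..<Suc s + h]" by (simp add: upt_rec)
  then have "mat_list_prod d (map B [s..<s + Suc h]) = B s * ?R" by (simp add: mat_list_prod_def)
  then have "mat_list_prod d (map B [s..<s + Suc h]) $$ (a, b) = (\<Sum>c<d. B s $$ (a, c) * ?R $$ (c, b))"
    using Bs R Suc.prems(2,3) by (simp add: scalar_prod_def atLeast0LessThan)
  also have "\<dots> = (\<Sum>c<d. B s $$ (a, c) * (\<Sum>w\<leftarrow>paths d h c b. \<Prod>t<h. B (Suc s + t) $$ (w ! t)))"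
    using Suc.prems by (intro sum.cong refl arg_cong2[of _ _ _ _ "(*)"] Suc.IH) auto
  also have "\<dots> = (\<Sum>c\<leftarrow>[0..<d]. \<Sum>w\<leftarrow>paths d h c b. B s $$ (a, c) * (\<Prod>t<h. B (Suc s + t) $$ (w ! t)))"
    by (simp add: interv_sum_list_conv_sum_set_nat atLeast0LessThan sum_list_const_mult)
  also have "\<dots> = (\<Sum>w\<leftarrow>paths d (Suc h) a b. \<Prod>t<Suc h. B (s + t) $$ (w ! t))"
    by (simp add: sum_list_concat_map o_def prod.lessThan_Suc_shift del: prod.lessThan_Suc)
  finally show ?case .
qed

text \<open>The offset \<open>s\<close> is general because splitting off the first block shifts the
  starting positions of all later ones.\<close>

lemma prod_mat_list_prod_path_words:
  fixes B :: "nat \<Rightarrow> 'a::comm_ring_1 mat"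
  assumes "\<And>t. t < s + sum_list lam \<Longrightarrow> B t \<in> carrier_mat d d"
    and "\<And>j. j < length lam \<Longrightarrow> fst (ab j) < d \<and> snd (ab j) < d"
  shows "(\<Prod>j<length lam. mat_list_prod d (map B [s + sum_list (take j lam)..<s + sum_list (take j lam) + lam ! j]) $$ ab j) =
    (\<Sum>w\<leftarrow>path_words d lam ab. \<Prod>t<sum_list lam. B (s + t) $$ (w ! t))"
  using assms
proof (induction lam arbitrary: s ab)
  case (Cons h lam)
  have ab0: "fst (ab 0) < d" "snd (ab 0) < d" using Cons.prems(2)[of 0] by auto
  let ?P = "path_words d lam (\<lambda>j. ab (Suc j))"
  have *: "(\<Prod>j<length lam. mat_list_prod d (map B [s + (h + sum_list (take j lam))..<s + (h + sum_list (take j lam)) + lam ! j]) $$ ab (Suc j)) =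
      (\<Sum>w\<leftarrow>?P. \<Prod>t<sum_list lam. B (s + h + t) $$ (w ! t))"
    using Cons.IH[of "s + h" "\<lambda>j. ab (Suc j)"] Cons.prems by (simp add: add.assoc)
  have **: "mat_list_prod d (map B [s..<s + h]) $$ ab 0 =
      (\<Sum>u\<leftarrow>paths d h (fst (ab 0)) (snd (ab 0)). \<Prod>t<h. B (s + t) $$ (u ! t))"
    using mat_list_prod_paths[of s h B d "fst (ab 0)" "snd (ab 0)"] Cons.prems(1) ab0 by simp
  have "(\<Prod>j<length (h # lam). mat_list_prod d (map B [s + sum_list (take j (h # lam))..<s + sum_list (take j (h # lam)) + (h # lam) ! j]) $$ ab j)
    = (\<Sum>u\<leftarrow>paths d h (fst (ab 0)) (snd (ab 0)). \<Prod>t<h. B (s + t) $$ (u ! t)) *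
      (\<Sum>w\<leftarrow>?P. \<Prod>t<sum_list lam. B (s + h + t) $$ (w ! t))"
    by (simp add: prod.lessThan_Suc_shift * ** del: prod.lessThan_Suc)
  also have "\<dots> = (\<Sum>u\<leftarrow>paths d h (fst (ab 0)) (snd (ab 0)). \<Sum>w\<leftarrow>?P.
      (\<Prod>t<h. B (s + t) $$ (u ! t)) * (\<Prod>t<sum_list lam. B (s + h + t) $$ (w ! t)))"
    by (simp add: sum_list_const_mult sum_list_mult_const[symmetric])
  also have "\<dots> = (\<Sum>u\<leftarrow>paths d h (fst (ab 0)) (snd (ab 0)). \<Sum>w\<leftarrow>?P.
      (\<Prod>t<h + sum_list lam. B (s + t) $$ ((u @ w) ! t)))"
  proof (intro arg_cong[of _ _ sum_list] map_cong refl)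
    fix u w assume "u \<in> set (paths d h (fst (ab 0)) (snd (ab 0)))"
    then have len: "length u = h" by (rule length_paths)
    have split: "(\<Prod>t<h + n. F t) = (\<Prod>t<h. F t) * (\<Prod>t<n. F (h + t))" for F :: "nat \<Rightarrow> 'a" and n
      by (induction n) (simp_all add: mult_ac)
    show "(\<Prod>t<h. B (s + t) $$ (u ! t)) * (\<Prod>t<sum_list lam. B (s + h + t) $$ (w ! t)) =
        (\<Prod>t<h + sum_list lam. B (s + t) $$ ((u @ w) ! t))"
      unfolding split by (simp add: nth_append len add.assoc)
  qed
  also have "\<dots> = (\<Sum>w\<leftarrow>path_words d (h # lam) ab. \<Prod>t<sum_list (h # lam). B (s + t) $$ (w ! t))"
    by (simp add: sum_list_concat_map o_def)
  finally show ?case .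
qed simp

lemma sum_sum_list_swap: "(\<Sum>p\<in>P. \<Sum>w\<leftarrow>ws. F p w) = (\<Sum>w\<leftarrow>ws. \<Sum>p\<in>P. F p w)"
  for F :: "'b \<Rightarrow> 'c \<Rightarrow> 'd::comm_monoid_add"
  by (induction ws) (simp_all add: sum.distrib)

text \<open>Both sides expand into the sum of \<open>alt_eval A w\<close> over the same path words,
  on the left after exchanging the sum over permutations with that over words.\<close>

lemma ST_eval_eq_ext_eval:
  fixes A :: "nat \<Rightarrow> 'a::field_char_0 mat"
  assumes A: "\<And>i. i < sum_list lam \<Longrightarrow> A i \<in> carrier_mat d d"
    and ab: "\<And>j. j < length lam \<Longrightarrow> fst (ab j) < d \<and> snd (ab j) < d"
  shows "ST_eval lam d A ab =
    ext_eval d (sum_list lam) A (entry_prod d (map (\<lambda>j. (lam ! j, ab j)) [0..<length lam]))"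
proof -
  let ?k = "sum_list lam"
  have "ST_eval lam d A ab = (\<Sum>p | p permutes {0..<?k}.
      \<Sum>w\<leftarrow>path_words d lam ab. of_int (sign p) * (\<Prod>t<?k. A (p t) $$ (w ! t)))"
    unfolding ST_eval_def
  proof (rule sum.cong[OF refl])
    fix p assume "p \<in> {p. p permutes {0..<?k}}"
    then have "A (p t) \<in> carrier_mat d d" if "t < ?k" for t
      using A[of "p t"] permutes_in_image[of p "{0..<?k}" t] that by simp
    then have "(\<Prod>j<length lam. mat_list_prod d (map (\<lambda>t. A (p t)) [sum_list (take j lam)..<sum_list (take j lam) + lam ! j]) $$ ab j) =
      (\<Sum>w\<leftarrow>path_words d lam ab. \<Prod>t<?k. A (p t) $$ (w ! t))"
      using prod_mat_list_prod_path_words[of 0 lam "\<lambda>t. A (p t)" d ab] ab by simp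
    then show "of_int (sign p) * (\<Prod>j<length lam. mat_list_prod d (map (\<lambda>t. A (p t)) [sum_list (take j lam)..<sum_list (take j lam) + lam ! j]) $$ ab j) =
      (\<Sum>w\<leftarrow>path_words d lam ab. of_int (sign p) * (\<Prod>t<?k. A (p t) $$ (w ! t)))"
      by (simp add: sum_list_const_mult)
  qed
  also have "\<dots> = (\<Sum>w\<leftarrow>path_words d lam ab. alt_eval A w)"
    unfolding sum_sum_list_swap
    by (intro arg_cong[of _ _ sum_list] map_cong refl) (simp add: alt_eval_def length_path_words)
  also have "\<dots> = (\<Sum>w\<leftarrow>path_words d lam ab. ext_eval d ?k A (word_prod w))"
    using ab by (intro arg_cong[of _ _ sum_list] map_cong refl ext_eval_word_prod[symmetric])
      (use set_path_words length_path_words in blast)+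
  finally show ?thesis by (simp only: ext_eval_sum_list entry_prod_path_words)
qed

text \<open>Evaluation at the matrix units of \<open>S\<close> is dual to the monomials of the same
  degree: the array is the identity for \<open>T\<close> = \<open>S\<close>, and otherwise an
  element of \<open>T\<close> outside \<open>S\<close> gives a zero column.\<close>

lemma alt_eval_matrix_units:
  assumes S: "finite S" "S \<subseteq> {..<d} \<times> {..<d}" and T: "finite T" "T \<subseteq> {..<d} \<times> {..<d}" "card T = card S"
  defines "A \<equiv> \<lambda>t. mat d d (\<lambda>ij. if ij = set_word S ! t then 1 else 0) :: 'a::comm_ring_1 mat"
  shows "alt_eval A (set_word T) = (if T = S then 1 else 0)"
proof -
  let ?n = "card S"
  have ent: "A s $$ (set_word T ! t) = (if set_word T ! t = set_word S ! s then 1 else 0)" if "t < ?n" for s t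
  proof -
    have "set_word T ! t \<in> T" using that T by (metis nth_mem length_sorted_list_of_set set_sorted_list_of_set)
    then obtain i j where "set_word T ! t = (i, j)" "i < d" "j < d" using T(2) by auto
    then show ?thesis by (simp add: A_def)
  qed
  have eval: "alt_eval A (set_word T) = (\<Sum>p | p permutes {0..<?n}. of_int (sign p) *
      (\<Prod>t<?n. if set_word T ! t = set_word S ! p t then 1 else 0))"
    unfolding alt_eval_def using T(3) by (auto intro!: sum.cong prod.cong simp: ent)
  show ?thesis
  proof (cases "T = S")
    case True
    have zero: "(\<Prod>t<?n. if set_word S ! t = set_word S ! p t then 1 else 0 :: 'a) = 0"
      if p: "p permutes {0..<?n}" "p \<noteq> id" for p
    proof -
      obtain t where t: "p t \<noteq> t" using p(2) by (auto simp: fun_eq_iff)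
      then have "t < ?n" using permutes_not_in[OF p(1), of t] by auto
      moreover have "p t < ?n" using permutes_in_image[OF p(1), of t] \<open>t < ?n\<close> by simp
      ultimately have "set_word S ! t \<noteq> set_word S ! p t" using t by (simp add: nth_eq_iff_index_eq)
      then show ?thesis using \<open>t < ?n\<close> by (intro prod_zero bexI[of _ t]) auto
    qed
    have "alt_eval A (set_word T) = (\<Sum>p\<in>{id}. of_int (sign p) *
      (\<Prod>t<?n. if set_word T ! t = set_word S ! p t then 1 else 0))"
      unfolding eval unfolding True
      by (rule sum.mono_neutral_right) (auto simp: finite_permutations permutes_id zero)
    then show ?thesis using True by simp
  next
    case False
    then obtain c where c: "c \<in> T" "c \<notin> S" using card_subset_eq[OF S(1), of T] T by blast
    then obtain t where t: "t < ?n" "set_word T ! t = c"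
      using T by (metis in_set_conv_nth length_sorted_list_of_set set_sorted_list_of_set)
    have "(\<Prod>t<?n. if set_word T ! t = set_word S ! p t then 1 else 0 :: 'a) = 0"
      if p: "p permutes {0..<?n}" for p
    proof -
      have "p t < ?n" using permutes_in_image[OF p, of t] t by simp
      then have "set_word S ! p t \<in> S" using S by (metis nth_mem length_sorted_list_of_set set_sorted_list_of_set)
      then have "set_word T ! t \<noteq> set_word S ! p t" using t c by auto
      then show ?thesis using t by (intro prod_zero bexI[of _ t]) auto
    qed
    then show ?thesis unfolding eval using False by (auto intro!: sum.neutral)
  qed
qed

text \<open>An evaluation is a linear functional applied to the product of entries, so it vanishes
  with that product. Conversely, evaluation at the matrix units of a monomial extracts its
  coefficient up to sign.\<close>

lemma ST_is_TPI_iff: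
  "ST_is_TPI TYPE('a::field_char_0) d lam \<longleftrightarrow> \<not> nonvanishing d (mset lam)"
proof
  assume tpi: "ST_is_TPI TYPE('a) d lam"
  show "\<not> nonvanishing d (mset lam)"
  proof
    assume "nonvanishing d (mset lam)"
    then obtain ts where ts: "map fst ts = lam" "entries_ok d ts" "entry_prod d ts \<noteq> 0"
      unfolding nonvanishing_mset by blast
    define ab where "ab = (\<lambda>j. snd (ts ! j))"
    have len: "length ts = length lam" using ts(1) by auto
    have ts_map: "map (\<lambda>j. (lam ! j, ab j)) [0..<length lam] = ts"
      using ts(1) by (intro nth_equalityI) (auto simp: ab_def)
    have ab: "fst (ab j) < d \<and> snd (ab j) < d" if "j < length lam" for j
      using ts(2) nth_mem[of j ts] that len by (auto simp: ab_def case_prod_unfold)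
    obtain S where S: "coef (entry_prod d ts) S \<noteq> 0" using ts(3) exterior_eqI[of "entry_prod d ts" 0] by auto
    then have SO: "S \<subseteq> {..<d} \<times> {..<d}" "card S = sum_list lam"
      using homog_entry_prod[OF ts(2)] ts(1) by (auto simp: homog_def)
    have fin: "finite S" using SO(1) by (rule finite_subset) simp
    define A where "A = (\<lambda>t. mat d d (\<lambda>ij. if ij = set_word S ! t then 1 else 0) :: 'a mat)"
    have "ext_eval d (sum_list lam) A (entry_prod d ts) =
        (\<Sum>T | T \<subseteq> {..<d} \<times> {..<d} \<and> card T = sum_list lam.
          if T = S then of_int (coef (entry_prod d ts) S * coef (word_prod (set_word S)) S) else 0)"
      unfolding ext_eval_def
    proof (rule sum.cong[OF refl])
      fix T assume "T \<in> {T. T \<subseteq> {..<d} \<times> {..<d} \<and> card T = sum_list lam}"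
      then have T: "finite T" "T \<subseteq> {..<d} \<times> {..<d}" "card T = card S"
        using SO(2) by (auto intro: finite_subset)
      show "of_int (coef (entry_prod d ts) T * coef (word_prod (set_word T)) T) * alt_eval A (set_word T) =
          (if T = S then of_int (coef (entry_prod d ts) S * coef (word_prod (set_word S)) S) else 0)"
        using alt_eval_matrix_units[OF fin SO(1) T, where ?'a = 'a] by (simp add: A_def)
    qed
    also have "\<dots> = of_int (coef (entry_prod d ts) S * coef (word_prod (set_word S)) S)"
      using SO by (subst sum.delta) (auto intro: finite_subset[of _ "Pow ({..<d} \<times> {..<d})"])
    \<comment> \<open>A nonzero integer times a sign stays nonzero in characteristic 0.\<close>
    also have "\<dots> \<noteq> 0"
      using S coef_word_prod_square[of "set_word S"] fin by auto
    finally have "ST_eval lam d A ab \<noteq> 0"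
      using ST_eval_eq_ext_eval[of lam A d ab] ab by (simp add: A_def ts_map)
    moreover have "\<forall>i < sum_list lam. A i \<in> carrier_mat d d" by (simp add: A_def)
    ultimately show False using tpi ab unfolding ST_is_TPI_def by blast
  qed
next
  assume nv: "\<not> nonvanishing d (mset lam)"
  show "ST_is_TPI TYPE('a) d lam"
    unfolding ST_is_TPI_def
  proof (intro allI impI)
    fix A :: "nat \<Rightarrow> 'a mat" and ab :: "nat \<Rightarrow> nat \<times> nat"
    assume A: "\<forall>i<sum_list lam. A i \<in> carrier_mat d d"
      and ab: "\<forall>j<length lam. fst (ab j) < d \<and> snd (ab j) < d"
    let ?ts = "map (\<lambda>j. (lam ! j, ab j)) [0..<length lam]"
    have "map fst ?ts = lam" by (simp add: o_def map_nth)
    moreover have "entries_ok d ?ts" using ab by (auto simp: case_prod_unfold)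
    ultimately have "entry_prod d ?ts = 0" using nv unfolding nonvanishing_mset by blast
    then show "ST_eval lam d A ab = 0"
      using ST_eval_eq_ext_eval[of lam A d ab] A ab by simp
  qed
qed

theorem mainTheorem11:
  fixes d m :: nat
  assumes "0 < d" and "0 < m" and "m \<le> 2 * d"
  shows "\<not> ST_is_TPI TYPE('a::field_char_0) d (thm_partition d m)
           \<longleftrightarrow> (even m \<or> (odd m \<and> m \<le> d))"
  using nonvanishing_partition_iff[OF assms] by (simp add: ST_is_TPI_iff)

end
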